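(* Let $\rho:G\Rightarrow H$ be a linear DPO derivation in $\mathcal C$ (with monic match $m:L\hookrightarrow G$, rule $L\xleftarrow{\ell}K\xrightarrow{r}R$ and context $d:D\hookrightarrow G$, $h:D\hookrightarrow H$). For every subobject $A\le G$ the following are equivalent: (1) $A$ is $\rho$-stable, i.e. $A\wedge L\le K$ in $\operatorname{Sub}(G)$; (2) $A\le D$ in $\operatorname{Sub}(G)$; (3) the monomorphism $A\hookrightarrow G$ factors through $d:D\hookrightarrow G$. Consequently $$\operatorname{Stab}(\rho)=\{A\in\operatorname{Sub}(G):A\le d(D)\},$$ and $D$ is the greatest subobject of $G$ transported intact through $\rho$.
   Context: Let $\mathcal H$ be the small category with a distinguished object $V$ and objects $E_{n,m}$ for $(n,m)\in\mathbb N^2$, freely generated by morphisms $s_i:E_{n,m}\to V$ ($1\le i\le n$) and $t_j:E_{n,m}\to V$ ($1\le j\le m$), with no equations beyond the category axioms. Let $\widehat{\mathcal H}=[\mathcal H,\mathbf{Set}]$ be the category of covariant functors, $\Sigma\in\widehat{\mathcal H}$ a fixed object, and $\mathcal C=\widehat{\mathcal H}/\Sigma$ the slice category (a Grothendieck topos). $\operatorname{Sub}(X)$ denotes the poset of subobjects of $X$, with meet $\wedge$ (pullback intersection) and join $\vee$. A linear DPO rule is a span of monomorphisms $L\xleftarrow{\ell}K\xrightarrow{r}R$ in $\mathcal C$. Given a monic match $m:L\hookrightarrow G$, a direct (linear DPO) derivation $\rho:G\Rightarrow H$ consists of an object $D$ (the context) and morphisms $k:K\to D$, $d:D\to G$,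 $h:D\to H$, $n:R\to H$ such that the squares $m\ell=dk$ and $nr=hk$ are both pushouts. Both $d$ and $h$ are monic. The objects $L,K,D$ are identified with their monic images in $G$ (via $m$, $m\ell=dk$, and $d$). A subobject $A\le G$ is called $\rho$-stable if $A\wedge L\le K$ in $\operatorname{Sub}(G)$; $\operatorname{Stab}(\rho)\subseteq\operatorname{Sub}(G)$ is the poset of $\rho$-stable subobjects. The subobjects transported intact through $\rho$ are the $\rho$-stable ones; a stable $a:A\hookrightarrow G$ with factorization $a=d\bar a$ is transported to $h\bar a:A\hookrightarrow H$. *)

theory Defs
  imports "HOL-Library.FuncSet" "HOL-Library.Infinite_Typeclass"
begin

section \<open>Categories\<close>

text \<open>\<open>Comp C g f\<close> is the composite \<open>g \<circ> f\<close> (first \<open>f\<close>, then \<open>g\<close>); it is meaningful only for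
  \<open>Cod C f = Dom C g\<close>.\<close>

record ('o, 'a) cat =
  Obj :: "'o set"
  Arr :: "'a set"
  Dom :: "'a \<Rightarrow> 'o"
  Cod :: "'a \<Rightarrow> 'o"
  Idn :: "'o \<Rightarrow> 'a"
  Comp :: "'a \<Rightarrow> 'a \<Rightarrow> 'a"

definition hom :: "('o, 'a) cat \<Rightarrow> 'o \<Rightarrow> 'o \<Rightarrow> 'a set" where
  "hom C X Y = {f \<in> Arr C. Dom C f = X \<and> Cod C f = Y}"

definition category :: "('o, 'a) cat \<Rightarrow> bool" where
  "category C \<longleftrightarrow>
     (\<forall>f\<in>Arr C. Dom C f \<in> Obj C \<and> Cod C f \<in> Obj C) \<and>
     (\<forall>X\<in>Obj C. Idn C X \<in> hom C X X) \<and>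
     (\<forall>f\<in>Arr C. \<forall>g\<in>Arr C. Cod C f = Dom C g \<longrightarrow> Comp C g f \<in> hom C (Dom C f) (Cod C g)) \<and>
     (\<forall>f\<in>Arr C. Comp C f (Idn C (Dom C f)) = f \<and> Comp C (Idn C (Cod C f)) f = f) \<and>
     (\<forall>f\<in>Arr C. \<forall>g\<in>Arr C. \<forall>h\<in>Arr C. Cod C f = Dom C g \<and> Cod C g = Dom C h \<longrightarrow>
        Comp C h (Comp C g f) = Comp C (Comp C h g) f)"

definition monic :: "('o, 'a) cat \<Rightarrow> 'a \<Rightarrow> bool" where
  "monic C f \<longleftrightarrow> f \<in> Arr C \<and>
     (\<forall>g\<in>Arr C. \<forall>h\<in>Arr C. Dom C g = Dom C h \<and> Cod C g = Dom C f \<and> Cod C h = Dom C f \<and>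
        Comp C f g = Comp C f h \<longrightarrow> g = h)"

definition isomorphism :: "('o, 'a) cat \<Rightarrow> 'a \<Rightarrow> bool" where
  "isomorphism C f \<longleftrightarrow> f \<in> Arr C \<and>
     (\<exists>g \<in> hom C (Cod C f) (Dom C f). Comp C g f = Idn C (Dom C f) \<and> Comp C f g = Idn C (Cod C f))"

text \<open>\<open>pushout C f g p q\<close>: the square \<open>p \<circ> f = q \<circ> g\<close> on the span \<open>(f, g)\<close> is a pushout.
  \<open>pullback C f g p q\<close>: the square \<open>f \<circ> p = g \<circ> q\<close> on the cospan \<open>(f, g)\<close> is a pullback.\<close>

definition pushout :: "('o, 'a) cat \<Rightarrow> 'a \<Rightarrow> 'a \<Rightarrow> 'a \<Rightarrow> 'a \<Rightarrow> bool" where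
  "pushout C f g p q \<longleftrightarrow>
     {f, g, p, q} \<subseteq> Arr C \<and> Dom C f = Dom C g \<and> Dom C p = Cod C f \<and> Dom C q = Cod C g \<and>
     Cod C p = Cod C q \<and> Comp C p f = Comp C q g \<and>
     (\<forall>p'\<in>Arr C. \<forall>q'\<in>Arr C.
        Dom C p' = Cod C f \<and> Dom C q' = Cod C g \<and> Cod C p' = Cod C q' \<and>
        Comp C p' f = Comp C q' g \<longrightarrow>
        (\<exists>!u. u \<in> hom C (Cod C p) (Cod C p') \<and> Comp C u p = p' \<and> Comp C u q = q'))"

definition pullback :: "('o, 'a) cat \<Rightarrow> 'a \<Rightarrow> 'a \<Rightarrow> 'a \<Rightarrow> 'a \<Rightarrow> bool" where
  "pullback C f g p q \<longleftrightarrow>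
     {f, g, p, q} \<subseteq> Arr C \<and> Cod C f = Cod C g \<and> Cod C p = Dom C f \<and> Cod C q = Dom C g \<and>
     Dom C p = Dom C q \<and> Comp C f p = Comp C g q \<and>
     (\<forall>p'\<in>Arr C. \<forall>q'\<in>Arr C.
        Cod C p' = Dom C f \<and> Cod C q' = Dom C g \<and> Dom C p' = Dom C q' \<and>
        Comp C f p' = Comp C g q' \<longrightarrow>
        (\<exists>!u. u \<in> hom C (Dom C p') (Dom C p) \<and> Comp C p u = p' \<and> Comp C q u = q'))"


section \<open>Subobjects\<close>

definition factors_through :: "('o, 'a) cat \<Rightarrow> 'a \<Rightarrow> 'a \<Rightarrow> bool" where
  "factors_through C a b \<longleftrightarrow> (\<exists>u \<in> hom C (Dom C a) (Dom C b). a = Comp C b u)"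

text \<open>A subobject of \<open>X\<close> is an isomorphism class of monomorphisms into \<open>X\<close>, and
  \<open>subobj C a\<close> is the one represented by \<open>a\<close>. This set is empty when \<open>a\<close> is not monic, hence
  \<open>subobj C a \<in> Sub C (Cod C a)\<close> contains the assertion that \<open>a\<close> is monic.\<close>

definition subobj :: "('o, 'a) cat \<Rightarrow> 'a \<Rightarrow> 'a set" where
  "subobj C a = {b. monic C b \<and>
     (\<exists>u. isomorphism C u \<and> u \<in> hom C (Dom C b) (Dom C a) \<and> b = Comp C a u)}"

definition Sub :: "('o, 'a) cat \<Rightarrow> 'o \<Rightarrow> 'a set set" where
  "Sub C X = {subobj C a |a. monic C a \<and> Cod C a = X}"

definition sub_le :: "('o, 'a) cat \<Rightarrow> 'a set \<Rightarrow> 'a set \<Rightarrow> bool" where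
  "sub_le C A B \<longleftrightarrow> (\<exists>a\<in>A. \<exists>b\<in>B. factors_through C a b)"

text \<open>The meet is the pullback intersection: the class of all diagonals \<open>a \<circ> p\<close> of pullbacks of
  representatives.\<close>

definition sub_meet :: "('o, 'a) cat \<Rightarrow> 'a set \<Rightarrow> 'a set \<Rightarrow> 'a set" where
  "sub_meet C A B = {Comp C a p |a b p q. a \<in> A \<and> b \<in> B \<and> pullback C a b p q}"


section \<open>Free, functor and slice categories\<close>

fun is_path :: "'e set \<Rightarrow> ('e \<Rightarrow> 'v) \<Rightarrow> ('e \<Rightarrow> 'v) \<Rightarrow> 'v \<Rightarrow> 'e list \<Rightarrow> 'v \<Rightarrow> bool" where
  "is_path E src tgt x [] y \<longleftrightarrow> x = y"
| "is_path E src tgt x (e # es) y \<longleftrightarrow> e \<in> E \<and> src e = x \<and> is_path E src tgt (tgt e) es y"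

definition free_cat ::
    "'v set \<Rightarrow> 'e set \<Rightarrow> ('e \<Rightarrow> 'v) \<Rightarrow> ('e \<Rightarrow> 'v) \<Rightarrow> ('v, 'v \<times> 'e list \<times> 'v) cat" where
  "free_cat V E src tgt =
     \<lparr> Obj = V,
       Arr = {(x, es, y). x \<in> V \<and> y \<in> V \<and> is_path E src tgt x es y},
       Dom = (\<lambda>(x, es, y). x),
       Cod = (\<lambda>(x, es, y). y),
       Idn = (\<lambda>x. (x, [], x)),
       Comp = (\<lambda>(y', fs, z) (x, es, y). (x, es @ fs, z)) \<rparr>"

text \<open>The category of sets and functions, with the type \<^typ>\<open>'u\<close> as universe: objects are the
  subsets of \<^typ>\<open>'u\<close>.\<close>

type_synonym 'u set_arr = "'u set \<times> ('u \<Rightarrow> 'u) \<times> 'u set"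

definition set_cat :: "('u set, 'u set_arr) cat" where
  "set_cat =
     \<lparr> Obj = UNIV,
       Arr = {(A, f, B). f \<in> A \<rightarrow>\<^sub>E B},
       Dom = (\<lambda>(A, f, B). A),
       Cod = (\<lambda>(A, f, B). B),
       Idn = (\<lambda>A. (A, restrict id A, A)),
       Comp = (\<lambda>(B', g, C) (A, f, B). (A, compose A g f, C)) \<rparr>"

type_synonym ('o, 'a, 'p, 'b) func = "('o \<Rightarrow> 'p) \<times> ('a \<Rightarrow> 'b)"

definition is_functor :: "('o, 'a) cat \<Rightarrow> ('p, 'b) cat \<Rightarrow> ('o, 'a, 'p, 'b) func \<Rightarrow> bool" where
  "is_functor C D F \<longleftrightarrow>
     fst F \<in> Obj C \<rightarrow>\<^sub>E Obj D \<and>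
     snd F \<in> extensional (Arr C) \<and>
     (\<forall>f\<in>Arr C. snd F f \<in> hom D (fst F (Dom C f)) (fst F (Cod C f))) \<and>
     (\<forall>X\<in>Obj C. snd F (Idn C X) = Idn D (fst F X)) \<and>
     (\<forall>f\<in>Arr C. \<forall>g\<in>Arr C. Cod C f = Dom C g \<longrightarrow>
        snd F (Comp C g f) = Comp D (snd F g) (snd F f))"

text \<open>The arrows of the functor category are the natural transformations, tagged with their
  domain and codomain functors.\<close>

definition natural_transf ::
    "('o, 'a) cat \<Rightarrow> ('p, 'b) cat \<Rightarrow> ('o, 'a, 'p, 'b) func \<Rightarrow> ('o \<Rightarrow> 'b) \<Rightarrow> ('o, 'a, 'p, 'b) func
      \<Rightarrow> bool" where
  "natural_transf C D F \<tau> G \<longleftrightarrow>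
     \<tau> \<in> extensional (Obj C) \<and>
     (\<forall>X\<in>Obj C. \<tau> X \<in> hom D (fst F X) (fst G X)) \<and>
     (\<forall>f\<in>Arr C. Comp D (\<tau> (Cod C f)) (snd F f) = Comp D (snd G f) (\<tau> (Dom C f)))"

type_synonym ('o, 'a, 'p, 'b) nat_arr =
  "('o, 'a, 'p, 'b) func \<times> ('o \<Rightarrow> 'b) \<times> ('o, 'a, 'p, 'b) func"

definition functor_cat ::
    "('o, 'a) cat \<Rightarrow> ('p, 'b) cat \<Rightarrow> (('o, 'a, 'p, 'b) func, ('o, 'a, 'p, 'b) nat_arr) cat" where
  "functor_cat C D =
     \<lparr> Obj = {F. is_functor C D F},
       Arr = {(F, \<tau>, G). is_functor C D F \<and> is_functor C D G \<and> natural_transf C D F \<tau> G},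
       Dom = (\<lambda>(F, \<tau>, G). F),
       Cod = (\<lambda>(F, \<tau>, G). G),
       Idn = (\<lambda>F. (F, restrict (\<lambda>X. Idn D (fst F X)) (Obj C), F)),
       Comp = (\<lambda>(G', \<sigma>, H) (F, \<tau>, G). (F, restrict (\<lambda>X. Comp D (\<sigma> X) (\<tau> X)) (Obj C), H)) \<rparr>"

definition slice :: "('o, 'a) cat \<Rightarrow> 'o \<Rightarrow> ('a, 'a \<times> 'a \<times> 'a) cat" where
  "slice C S =
     \<lparr> Obj = {p \<in> Arr C. Cod C p = S},
       Arr = {(p, f, q). p \<in> Arr C \<and> Cod C p = S \<and> q \<in> Arr C \<and> Cod C q = S \<and>
                         f \<in> hom C (Dom C p) (Dom C q) \<and> Comp C q f = p},
       Dom = (\<lambda>(p, f, q). p),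
       Cod = (\<lambda>(p, f, q). q),
       Idn = (\<lambda>p. (p, Idn C (Dom C p), p)),
       Comp = (\<lambda>(q', g, r) (p, f, q). (p, Comp C g f, r)) \<rparr>"


section \<open>Hypergraphs\<close>

datatype hyp_obj = Vert | Edge nat nat

text \<open>\<open>SrcGen n m i\<close> is \<open>s\<^sub>i : E\<^sub>n\<^sub>,\<^sub>m \<rightarrow> V\<close> and \<open>TgtGen n m j\<close> is \<open>t\<^sub>j : E\<^sub>n\<^sub>,\<^sub>m \<rightarrow> V\<close>.\<close>

datatype hyp_gen = SrcGen nat nat nat | TgtGen nat nat nat

fun gen_dom :: "hyp_gen \<Rightarrow> hyp_obj" where
  "gen_dom (SrcGen n m i) = Edge n m"
| "gen_dom (TgtGen n m j) = Edge n m"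

definition hyp_gens :: "hyp_gen set" where
  "hyp_gens = {SrcGen n m i |n m i. 1 \<le> i \<and> i \<le> n} \<union> {TgtGen n m j |n m j. 1 \<le> j \<and> j \<le> m}"

type_synonym hyp_arr = "hyp_obj \<times> hyp_gen list \<times> hyp_obj"

definition hyp_cat :: "(hyp_obj, hyp_arr) cat" where
  "hyp_cat = free_cat UNIV hyp_gens gen_dom (\<lambda>_. Vert)"

type_synonym 'u hypergraph = "(hyp_obj, hyp_arr, 'u set, 'u set_arr) func"
type_synonym 'u hypergraph_arr = "(hyp_obj, hyp_arr, 'u set, 'u set_arr) nat_arr"

text \<open>For a finite universe \<^typ>\<open>'u\<close> the category of subsets of \<^typ>\<open>'u\<close> lacks coproducts, and its
  pushout squares need not be pushouts of sets; hence the sort constraint.\<close>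

definition hypergraphs :: "('u::infinite hypergraph, 'u hypergraph_arr) cat" where
  "hypergraphs = functor_cat hyp_cat set_cat"


section \<open>The constructions above yield categories\<close>

lemma is_path_append: "is_path E s t x es y \<Longrightarrow> is_path E s t y fs z \<Longrightarrow> is_path E s t x (es @ fs) z"
  by (induction es arbitrary: x) auto

lemma category_free_cat: "category (free_cat V E src tgt)"
  by (auto simp: category_def free_cat_def hom_def intro: is_path_append)

lemma category_set_cat: "category set_cat"
proof -
  have e: "restrict id A x = (if x \<in> A then x else undefined)" for A and x :: 'a by simp
  show ?thesis
    unfolding category_def set_cat_def hom_def
    by (auto simp: compose_def fun_eq_iff PiE_def extensional_def Pi_iff)
qed

lemma category_slice:
  assumes "category C" shows "category (slice C S)"
proof -
  have C: "\<And>f. f \<in> Arr C \<Longrightarrow> Dom C f \<in> Obj C"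
    "\<And>X. X \<in> Obj C \<Longrightarrow> Idn C X \<in> Arr C" "\<And>X. X \<in> Obj C \<Longrightarrow> Dom C (Idn C X) = X"
    "\<And>X. X \<in> Obj C \<Longrightarrow> Cod C (Idn C X) = X"
    "\<And>f g. f \<in> Arr C \<Longrightarrow> g \<in> Arr C \<Longrightarrow> Cod C f = Dom C g \<Longrightarrow> Comp C g f \<in> Arr C"
    "\<And>f g. f \<in> Arr C \<Longrightarrow> g \<in> Arr C \<Longrightarrow> Cod C f = Dom C g \<Longrightarrow> Dom C (Comp C g f) = Dom C f"
    "\<And>f g. f \<in> Arr C \<Longrightarrow> g \<in> Arr C \<Longrightarrow> Cod C f = Dom C g \<Longrightarrow> Cod C (Comp C g f) = Cod C g"
    "\<And>f X. f \<in> Arr C \<Longrightarrow> Dom C f = X \<Longrightarrow> Comp C f (Idn C X) = f"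
    "\<And>f X. f \<in> Arr C \<Longrightarrow> Cod C f = X \<Longrightarrow> Comp C (Idn C X) f = f"
    using assms unfolding category_def hom_def by auto
  have A: "\<And>f g h. f \<in> Arr C \<Longrightarrow> g \<in> Arr C \<Longrightarrow> h \<in> Arr C \<Longrightarrow> Cod C f = Dom C g \<Longrightarrow> Cod C g = Dom C h
     \<Longrightarrow> Comp C h (Comp C g f) = Comp C (Comp C h g) f"
    using assms unfolding category_def by auto
  show ?thesis
    unfolding category_def
    apply (intro conjI)
    subgoal by (auto simp: slice_def)
    subgoal by (auto simp: slice_def hom_def C)
    subgoal by (clarsimp simp: slice_def hom_def) (metis A C(5,6,7))
    subgoal by (auto simp: slice_def hom_def C)
    subgoal by (clarsimp simp: slice_def hom_def) (metis A)
    done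
qed

lemma category_functor_cat:
  assumes "category C" "category D" shows "category (functor_cat C D)"
proof -
  have C: "\<And>f. f \<in> Arr C \<Longrightarrow> Dom C f \<in> Obj C" "\<And>f. f \<in> Arr C \<Longrightarrow> Cod C f \<in> Obj C"
    using assms(1) unfolding category_def by auto
  have D: "\<And>f. f \<in> Arr D \<Longrightarrow> Dom D f \<in> Obj D" "\<And>f. f \<in> Arr D \<Longrightarrow> Cod D f \<in> Obj D"
   "\<And>X. X \<in> Obj D \<Longrightarrow> Idn D X \<in> Arr D" "\<And>X. X \<in> Obj D \<Longrightarrow> Dom D (Idn D X) = X"
   "\<And>X. X \<in> Obj D \<Longrightarrow> Cod D (Idn D X) = X"
   "\<And>f g. f \<in> Arr D \<Longrightarrow> g \<in> Arr D \<Longrightarrow> Cod D f = Dom D g \<Longrightarrow> Comp D g f \<in> Arr D"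
   "\<And>f g. f \<in> Arr D \<Longrightarrow> g \<in> Arr D \<Longrightarrow> Cod D f = Dom D g \<Longrightarrow> Dom D (Comp D g f) = Dom D f"
   "\<And>f g. f \<in> Arr D \<Longrightarrow> g \<in> Arr D \<Longrightarrow> Cod D f = Dom D g \<Longrightarrow> Cod D (Comp D g f) = Cod D g"
   "\<And>f X. f \<in> Arr D \<Longrightarrow> Dom D f = X \<Longrightarrow> Comp D f (Idn D X) = f"
   "\<And>f X. f \<in> Arr D \<Longrightarrow> Cod D f = X \<Longrightarrow> Comp D (Idn D X) f = f"
    using assms(2) unfolding category_def hom_def by auto
  have A: "\<And>f g h. f \<in> Arr D \<Longrightarrow> g \<in> Arr D \<Longrightarrow> h \<in> Arr D \<Longrightarrow> Cod D f = Dom D g \<Longrightarrow> Cod D g = Dom D h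
     \<Longrightarrow> Comp D h (Comp D g f) = Comp D (Comp D h g) f"
    using assms(2) unfolding category_def by auto
  have nat: "natural_transf C D F (restrict (\<lambda>X. Comp D (s X) (t X)) (Obj C)) H"
    if F: "is_functor C D F" and G: "is_functor C D G" and H: "is_functor C D H"
     and t: "natural_transf C D F t G" and s: "natural_transf C D G s H" for F G H s t
    unfolding natural_transf_def
  proof (intro conjI ballI)
    fix f assume f: "f \<in> Arr C"
    note nt = f C[OF f]
    have a: "t (Dom C f) \<in> hom D (fst F (Dom C f)) (fst G (Dom C f))"
      "t (Cod C f) \<in> hom D (fst F (Cod C f)) (fst G (Cod C f))"
      "s (Dom C f) \<in> hom D (fst G (Dom C f)) (fst H (Dom C f))"
      "s (Cod C f) \<in> hom D (fst G (Cod C f)) (fst H (Cod C f))"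
      "snd F f \<in> hom D (fst F (Dom C f)) (fst F (Cod C f))"
      "snd G f \<in> hom D (fst G (Dom C f)) (fst G (Cod C f))"
      "snd H f \<in> hom D (fst H (Dom C f)) (fst H (Cod C f))"
      using nt F G H s t unfolding natural_transf_def is_functor_def by auto
    have n: "Comp D (t (Cod C f)) (snd F f) = Comp D (snd G f) (t (Dom C f))"
       "Comp D (s (Cod C f)) (snd G f) = Comp D (snd H f) (s (Dom C f))"
      using nt s t unfolding natural_transf_def by auto
    show "Comp D (restrict (\<lambda>X. Comp D (s X) (t X)) (Obj C) (Cod C f)) (snd F f) =
         Comp D (snd H f) (restrict (\<lambda>X. Comp D (s X) (t X)) (Obj C) (Dom C f))"
      using nt a n A unfolding hom_def by simp metis
  qed (use t s D in \<open>auto simp: natural_transf_def hom_def\<close>)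
  have ob: "\<And>F X. is_functor C D F \<Longrightarrow> X \<in> Obj C \<Longrightarrow> fst F X \<in> Obj D"
    unfolding is_functor_def by auto
  have idn: "natural_transf C D F (restrict (\<lambda>X. Idn D (fst F X)) (Obj C)) F" if "is_functor C D F" for F
    using that C D ob[OF that] unfolding natural_transf_def is_functor_def hom_def by auto
  have idl: "Comp (functor_cat C D) f (Idn (functor_cat C D) (Dom (functor_cat C D) f)) = f \<and>
      Comp (functor_cat C D) (Idn (functor_cat C D) (Cod (functor_cat C D) f)) f = f"
    if f: "f \<in> Arr (functor_cat C D)" for f
  proof -
    obtain F t G where e: "f = (F, t, G)" "natural_transf C D F t G"
      using f by (auto simp: functor_cat_def)
    have "Comp D (t X) (Idn D (fst F X)) = t X" "Comp D (Idn D (fst G X)) (t X) = t X"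
      if "X \<in> Obj C" for X
      using e that D unfolding natural_transf_def hom_def by auto
    moreover have "t X = undefined" if "X \<notin> Obj C" for X
      using e that unfolding natural_transf_def extensional_def by auto
    ultimately show ?thesis by (auto simp: e functor_cat_def fun_eq_iff restrict_def)
  qed
  have ass: "Comp D (u X) (Comp D (s X) (t X)) = Comp D (Comp D (u X) (s X)) (t X)"
    if "natural_transf C D F t G" "natural_transf C D G s H" "natural_transf C D H u K" "X \<in> Obj C"
    for F G H K t s u X
    using that A unfolding natural_transf_def hom_def by simp
  have assoc: "Comp (functor_cat C D) h (Comp (functor_cat C D) g f) =
      Comp (functor_cat C D) (Comp (functor_cat C D) h g) f"
    if fgh: "f \<in> Arr (functor_cat C D)" "g \<in> Arr (functor_cat C D)" "h \<in> Arr (functor_cat C D)"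
      "Cod (functor_cat C D) f = Dom (functor_cat C D) g" "Cod (functor_cat C D) g = Dom (functor_cat C D) h" for f g h
  proof -
    obtain F t G where f: "f = (F, t, G)" "natural_transf C D F t G"
      using fgh(1) by (auto simp: functor_cat_def)
    obtain G' s H where g: "g = (G', s, H)" "natural_transf C D G' s H"
      using fgh(2) by (auto simp: functor_cat_def)
    obtain H' u K where h: "h = (H', u, K)" "natural_transf C D H' u K"
      using fgh(3) by (auto simp: functor_cat_def)
    have e: "G' = G" "H' = H" using fgh(4,5) f(1) g(1) h(1) by (auto simp: functor_cat_def)
    have "Comp D (u X) (Comp D (s X) (t X)) = Comp D (Comp D (u X) (s X)) (t X)" if "X \<in> Obj C" for X
      by (rule ass[OF f(2) g(2)[unfolded e] h(2)[unfolded e] that])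
    then have "restrict (\<lambda>X. Comp D (u X) (restrict (\<lambda>X. Comp D (s X) (t X)) (Obj C) X)) (Obj C)
      = restrict (\<lambda>X. Comp D (restrict (\<lambda>X. Comp D (u X) (s X)) (Obj C) X) (t X)) (Obj C)"
      by (intro restrict_ext) simp
    then show ?thesis unfolding f(1) g(1) h(1) functor_cat_def by simp
  qed
  show ?thesis unfolding category_def
    apply (intro conjI)
    subgoal by (auto simp: functor_cat_def)
    subgoal using idn by (auto simp: functor_cat_def hom_def)
    subgoal using nat by (auto simp: functor_cat_def hom_def)
    subgoal using idl by blast
    subgoal using assoc by blast
    done
qed

lemma category_slice_hypergraphs: "category (slice hypergraphs \<Sigma>)"
  by (simp add: category_slice hypergraphs_def hyp_cat_def category_functor_cat
      category_free_cat category_set_cat)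


section \<open>Linear double-pushout rewriting\<close>

definition linear_rule :: "('o, 'a) cat \<Rightarrow> 'a \<Rightarrow> 'a \<Rightarrow> bool" where
  "linear_rule C l r \<longleftrightarrow> monic C l \<and> monic C r \<and> Dom C l = Dom C r"

text \<open>The derivation with rule \<open>L \<leftarrow>l\<midarrow> K \<midarrow>r\<rightarrow> R\<close>, match \<open>m : L \<rightarrow> G\<close>, context
  \<open>k : K \<rightarrow> D\<close>, \<open>d : D \<rightarrow> G\<close>, \<open>h : D \<rightarrow> H\<close>, and comatch \<open>n : R \<rightarrow> H\<close>. That \<open>d\<close> and \<open>h\<close> are monic
  is a consequence and not part of the definition.\<close>

definition dpo_derivation ::
    "('o, 'a) cat \<Rightarrow> 'a \<Rightarrow> 'a \<Rightarrow> 'a \<Rightarrow> 'a \<Rightarrow> 'a \<Rightarrow> 'a \<Rightarrow> 'a \<Rightarrow> bool" where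
  "dpo_derivation C l r m k d h n \<longleftrightarrow>
     linear_rule C l r \<and> monic C m \<and> pushout C l k m d \<and> pushout C r k n h"

definition rho_stable :: "('o, 'a) cat \<Rightarrow> 'a \<Rightarrow> 'a \<Rightarrow> 'a set \<Rightarrow> bool" where
  "rho_stable C l m A \<longleftrightarrow> sub_le C (sub_meet C A (subobj C m)) (subobj C (Comp C m l))"

definition Stab :: "('o, 'a) cat \<Rightarrow> 'a \<Rightarrow> 'a \<Rightarrow> 'a set set" where
  "Stab C l m = {A \<in> Sub C (Cod C m). rho_stable C l m A}"

text \<open>The subobjects of \<open>G\<close> transported intact are the stable ones; a stable \<open>a = d \<circ> a'\<close> is
  transported to the subobject of \<open>H\<close> represented by \<open>h \<circ> a'\<close>.\<close>

definition transported_to ::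
    "('o, 'a) cat \<Rightarrow> 'a \<Rightarrow> 'a \<Rightarrow> 'a \<Rightarrow> 'a \<Rightarrow> 'a set \<Rightarrow> 'a set \<Rightarrow> bool" where
  "transported_to C l m d h A B \<longleftrightarrow>
     A \<in> Stab C l m \<and> B \<in> Sub C (Cod C h) \<and>
     (\<exists>a\<in>A. \<exists>a' \<in> hom C (Dom C a) (Dom C d). a = Comp C d a' \<and> B = subobj C (Comp C h a'))"

definition transported_intact ::
    "('o, 'a) cat \<Rightarrow> 'a \<Rightarrow> 'a \<Rightarrow> 'a \<Rightarrow> 'a \<Rightarrow> 'a set \<Rightarrow> bool" where
  "transported_intact C l m d h A \<longleftrightarrow> (\<exists>B. transported_to C l m d h A B)"

end

theory Submission imports Defs begin

text \<open>In a category of set-valued functors over a fixed one, all the notions of the theorem can be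
  read off from images, object by object. Write \<open>A\<close>, \<open>L\<close>, \<open>K\<close>, \<open>D\<close> for the images in \<open>G\<close> at some
  object. The pushout square of \<open>l\<close> and \<open>k\<close> gives two equations:
  \<open>L \<union> D = G\<close> (\<open>pushout_jointly_surjective\<close>) and, because \<open>l\<close> is monic, \<open>L \<inter> D = K\<close>
  (\<open>pushout_along_injective\<close>). For \<open>A \<subseteq> L \<union> D\<close> these make \<open>A \<inter> L \<subseteq> K\<close> equivalent to \<open>A \<subseteq> D\<close>: an
  element of \<open>A\<close> outside \<open>D\<close> lies in \<open>L\<close>, hence in \<open>K \<subseteq> D\<close>; conversely \<open>A \<inter> L \<subseteq> D \<inter> L = K\<close>.

  Neither equation requires computing the pushout. Each comes from applying the universal property
  to one concrete object: the union of the two images in \<open>G\<close> for the first, and the sets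
  \<open>D + (L - K)\<close> for the second. The latter must again consist of elements of the universe type,
  and so must the pullbacks that exhibit meets and kernel pairs; this is what the infinity of that
  type provides, through an injection of its square into itself.

  The passage between the categorical and the elementwise notions consists of three facts:
  a morphism is monic iff its components are injective (\<open>monic_iff_injective\<close>), factoring through a
  monomorphism is inclusion of images (\<open>factors_through_iff_range\<close>), and a meet lies below a
  subobject iff the intersection of the images is contained in its image (\<open>meet_le_iff_range\<close>).
  The index category is arbitrary; hypergraphs are one instance.\<close>

section \<open>Arrows of a category\<close>

lemma hom_iff: "f \<in> hom C X Y \<longleftrightarrow> f \<in> Arr C \<and> Dom C f = X \<and> Cod C f = Y"
  by (simp add: hom_def)

lemma homD: "f \<in> hom C X Y \<Longrightarrow> f \<in> Arr C" "f \<in> hom C X Y \<Longrightarrow> Dom C f = X"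
  "f \<in> hom C X Y \<Longrightarrow> Cod C f = Y"
  by (simp_all add: hom_iff)

lemma
  assumes "category C"
  shows Dom_in_Obj: "f \<in> Arr C \<Longrightarrow> Dom C f \<in> Obj C"
    and Cod_in_Obj: "f \<in> Arr C \<Longrightarrow> Cod C f \<in> Obj C"
    and Idn_in_hom: "X \<in> Obj C \<Longrightarrow> Idn C X \<in> hom C X X"
    and Comp_in_hom: "f \<in> hom C X Y \<Longrightarrow> g \<in> hom C Y Z \<Longrightarrow> Comp C g f \<in> hom C X Z"
    and Comp_Idn: "f \<in> hom C X Y \<Longrightarrow> Comp C f (Idn C X) = f"
    and Idn_Comp: "f \<in> hom C X Y \<Longrightarrow> Comp C (Idn C Y) f = f"
    and Comp_assoc: "f \<in> hom C X Y \<Longrightarrow> g \<in> hom C Y Z \<Longrightarrow> h \<in> hom C Z W \<Longrightarrow>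
           Comp C h (Comp C g f) = Comp C (Comp C h g) f"
  using assms unfolding category_def hom_iff by auto

lemma pushout_homs:
  assumes "pushout C f g p q"
  shows "f \<in> hom C (Dom C f) (Cod C f)" "g \<in> hom C (Dom C f) (Cod C g)"
    "p \<in> hom C (Cod C f) (Cod C p)" "q \<in> hom C (Cod C g) (Cod C p)"
    "Comp C p f = Comp C q g"
  using assms by (auto simp: pushout_def hom_iff)

lemma pushout_ex1:
  assumes "pushout C f g p q" "p' \<in> hom C (Cod C f) Z" "q' \<in> hom C (Cod C g) Z"
    "Comp C p' f = Comp C q' g"
  shows "\<exists>!u. u \<in> hom C (Cod C p) Z \<and> Comp C u p = p' \<and> Comp C u q = q'"
proof -
  have "p' \<in> Arr C" "q' \<in> Arr C" "Dom C p' = Cod C f \<and> Dom C q' = Cod C g \<and>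
      Cod C p' = Cod C q' \<and> Comp C p' f = Comp C q' g"
    using homD[OF assms(2)] homD[OF assms(3)] assms(4) by simp_all
  with assms(1) have "\<exists>!u. u \<in> hom C (Cod C p) (Cod C p') \<and> Comp C u p = p' \<and> Comp C u q = q'"
    unfolding pushout_def by blast
  then show ?thesis using homD(3)[OF assms(2)] by simp
qed

lemma pullback_ex1:
  assumes "pullback C f g p q" "p' \<in> hom C W (Dom C f)" "q' \<in> hom C W (Dom C g)"
    "Comp C f p' = Comp C g q'"
  shows "\<exists>!u. u \<in> hom C W (Dom C p) \<and> Comp C p u = p' \<and> Comp C q u = q'"
proof -
  have "p' \<in> Arr C" "q' \<in> Arr C" "Cod C p' = Dom C f \<and> Cod C q' = Dom C g \<and>
      Dom C p' = Dom C q' \<and> Comp C f p' = Comp C g q'"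
    using homD[OF assms(2)] homD[OF assms(3)] assms(4) by simp_all
  with assms(1) have "\<exists>!u. u \<in> hom C (Dom C p') (Dom C p) \<and> Comp C p u = p' \<and> Comp C q u = q'"
    unfolding pullback_def by blast
  then show ?thesis using homD(2)[OF assms(2)] by simp
qed

lemma pullbackI:
  assumes f: "f \<in> hom C X Z" and g: "g \<in> hom C Y Z" and p: "p \<in> hom C P X" and q: "q \<in> hom C P Y"
    and eq: "Comp C f p = Comp C g q"
    and u: "\<And>W p' q'. p' \<in> hom C W X \<Longrightarrow> q' \<in> hom C W Y \<Longrightarrow> Comp C f p' = Comp C g q' \<Longrightarrow>
      \<exists>!u. u \<in> hom C W P \<and> Comp C p u = p' \<and> Comp C q u = q'"
  shows "pullback C f g p q"
  unfolding pullback_def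
proof (intro conjI ballI impI)
  fix p' q' assume "p' \<in> Arr C" "q' \<in> Arr C"
    "Cod C p' = Dom C f \<and> Cod C q' = Dom C g \<and> Dom C p' = Dom C q' \<and> Comp C f p' = Comp C g q'"
  then have "\<exists>!u. u \<in> hom C (Dom C p') P \<and> Comp C p u = p' \<and> Comp C q u = q'"
    using homD[OF f] homD[OF g] by (intro u) (simp_all add: hom_iff)
  then show "\<exists>!u. u \<in> hom C (Dom C p') (Dom C p) \<and> Comp C p u = p' \<and> Comp C q u = q'"
    using homD(2)[OF p] by simp
qed (use homD[OF f] homD[OF g] homD[OF p] homD[OF q] eq in auto)

lemma monic_cancel:
  assumes "monic C f" "g \<in> hom C W (Dom C f)" "h \<in> hom C W (Dom C f)" "Comp C f g = Comp C f h"
  shows "g = h"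
proof -
  have "g \<in> Arr C" "h \<in> Arr C" "Dom C g = Dom C h" "Cod C g = Dom C f" "Cod C h = Dom C f"
    using homD[OF assms(2)] homD[OF assms(3)] by simp_all
  with assms(1,4) show ?thesis unfolding monic_def by blast
qed

lemma monicI:
  assumes f: "f \<in> hom C X Y"
    and c: "\<And>W g h. g \<in> hom C W X \<Longrightarrow> h \<in> hom C W X \<Longrightarrow> Comp C f g = Comp C f h \<Longrightarrow> g = h"
  shows "monic C f"
  unfolding monic_def using homD[OF f] by (auto simp: hom_iff intro: c)

lemma monic_Comp:
  assumes C: "category C" and f: "f \<in> hom C X Y" "monic C f" and g: "g \<in> hom C Y Z" "monic C g"
  shows "monic C (Comp C g f)"
proof (rule monicI[OF Comp_in_hom[OF C f(1) g(1)]])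
  fix W u w assume u: "u \<in> hom C W X" and w: "w \<in> hom C W X"
    and eq: "Comp C (Comp C g f) u = Comp C (Comp C g f) w"
  have "Comp C g (Comp C f u) = Comp C g (Comp C f w)"
    using eq Comp_assoc[OF C u f(1) g(1)] Comp_assoc[OF C w f(1) g(1)] by simp
  then have "Comp C f u = Comp C f w"
    using monic_cancel[OF g(2)] Comp_in_hom[OF C u f(1)] Comp_in_hom[OF C w f(1)] homD(2)[OF g(1)]
    by simp
  then show "u = w" using monic_cancel[OF f(2)] u w homD(2)[OF f(1)] by simp
qed

section \<open>Representatives of subobjects\<close>

lemma factors_through_refl:
  assumes "category C" "f \<in> Arr C" shows "factors_through C f f"
  unfolding factors_through_def
  using assms Idn_in_hom[OF assms(1) Dom_in_Obj[OF assms]] Comp_Idn[OF assms(1), of f "Dom C f" "Cod C f"]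
  by (force simp: hom_iff)

lemma factors_through_trans:
  assumes C: "category C" and c: "c \<in> Arr C"
    and bc: "factors_through C b c" and ab: "factors_through C a b"
  shows "factors_through C a c"
proof -
  obtain u where u: "u \<in> hom C (Dom C b) (Dom C c)" "b = Comp C c u"
    using bc by (auto simp: factors_through_def)
  obtain w where w: "w \<in> hom C (Dom C a) (Dom C b)" "a = Comp C b w"
    using ab by (auto simp: factors_through_def)
  have "a = Comp C c (Comp C u w)"
    using Comp_assoc[OF C w(1) u(1), of c "Cod C c"] c u(2) w(2) by (simp add: hom_iff)
  then show ?thesis
    using Comp_in_hom[OF C w(1) u(1)] by (auto simp: factors_through_def)
qed

lemma self_in_subobj:
  assumes "category C" "monic C a" shows "a \<in> subobj C a"
proof -
  have a: "a \<in> hom C (Dom C a) (Cod C a)" using assms by (simp add: monic_def hom_iff)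
  have i: "Idn C (Dom C a) \<in> hom C (Dom C a) (Dom C a)"
    using Idn_in_hom[OF assms(1) Dom_in_Obj[OF assms(1)]] a by (simp add: hom_iff)
  then have "isomorphism C (Idn C (Dom C a))"
    using Comp_Idn[OF assms(1) i] by (auto simp: isomorphism_def hom_iff)
  then show ?thesis
    using assms i Comp_Idn[OF assms(1) a] by (auto simp: subobj_def)
qed

lemma subobj_mutual_factors:
  assumes C: "category C" and a: "a \<in> Arr C" and b: "b \<in> subobj C a"
  shows "b \<in> Arr C" "factors_through C b a" "factors_through C a b" "Cod C b = Cod C a"
proof -
  obtain u w where u: "b \<in> Arr C" "u \<in> hom C (Dom C b) (Dom C a)" "b = Comp C a u"
    and w: "w \<in> hom C (Dom C a) (Dom C b)" "Comp C u w = Idn C (Dom C a)"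
    using b by (auto simp: subobj_def monic_def isomorphism_def hom_iff)
  have a': "a \<in> hom C (Dom C a) (Cod C a)" using a by (simp add: hom_iff)
  show "b \<in> Arr C" by (rule u)
  show "factors_through C b a" using u by (auto simp: factors_through_def)
  have "Comp C b w = a"
    using Comp_assoc[OF C w(1) u(2) a'] Comp_Idn[OF C a'] u(3) w(2) by simp
  then show "factors_through C a b" using w by (auto simp: factors_through_def)
  show "Cod C b = Cod C a" using Comp_in_hom[OF C u(2) a'] u(3) by (simp add: hom_iff)
qed

lemma sub_le_subobj_iff:
  assumes C: "category C" and a: "monic C a" and b: "monic C b"
  shows "sub_le C (subobj C a) (subobj C b) \<longleftrightarrow> factors_through C a b"
proof
  have ab: "a \<in> Arr C" "b \<in> Arr C" using a b by (auto simp: monic_def)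
  assume "sub_le C (subobj C a) (subobj C b)"
  then obtain a' b' where 1: "a' \<in> subobj C a" "b' \<in> subobj C b" "factors_through C a' b'"
    by (auto simp: sub_le_def)
  note A = subobj_mutual_factors[OF C ab(1) 1(1)] and B = subobj_mutual_factors[OF C ab(2) 1(2)]
  show "factors_through C a b"
    using factors_through_trans[OF C] A B 1(3) ab by metis
next
  assume "factors_through C a b"
  then show "sub_le C (subobj C a) (subobj C b)"
    using self_in_subobj[OF C a] self_in_subobj[OF C b] by (auto simp: sub_le_def)
qed

text \<open>The meet is a set of composites taken over all pullbacks of all representatives. Pullbacks of
  isomorphic cospans are isomorphic, so one pullback of one pair of representatives decides
  whether the meet is below a subobject. Its existence matters: an empty meet is below nothing.\<close>

lemma sub_le_meet_iff:
  assumes C: "category C" and a: "monic C a" and b: "monic C b" and c: "monic C c"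
    and pb: "pullback C a b p q"
  shows "sub_le C (sub_meet C (subobj C a) (subobj C b)) (subobj C c)
    \<longleftrightarrow> factors_through C (Comp C a p) c"
proof
  have arr: "a \<in> Arr C" "b \<in> Arr C" "c \<in> Arr C" using a b c by (auto simp: monic_def)
  have pq: "p \<in> hom C (Dom C p) (Dom C a)" "q \<in> hom C (Dom C p) (Dom C b)"
    "Comp C a p = Comp C b q" "Cod C a = Cod C b"
    using pb by (auto simp: pullback_def hom_iff)
  assume "sub_le C (sub_meet C (subobj C a) (subobj C b)) (subobj C c)"
  then obtain a' b' c' p' q' where 1: "a' \<in> subobj C a" "b' \<in> subobj C b" "c' \<in> subobj C c"
      "factors_through C (Comp C a' p') c'" and pb': "pullback C a' b' p' q'"
    by (auto simp: sub_le_def sub_meet_def)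
  note A = subobj_mutual_factors[OF C arr(1) 1(1)] and B = subobj_mutual_factors[OF C arr(2) 1(2)]
    and D = subobj_mutual_factors[OF C arr(3) 1(3)]
  obtain u where u: "u \<in> hom C (Dom C a) (Dom C a')" "a = Comp C a' u"
    using A(3) by (auto simp: factors_through_def)
  obtain w where w: "w \<in> hom C (Dom C b) (Dom C b')" "b = Comp C b' w"
    using B(3) by (auto simp: factors_through_def)
  have a': "a' \<in> hom C (Dom C a') (Cod C a)" and b': "b' \<in> hom C (Dom C b') (Cod C b)"
    using A B by (auto simp: hom_iff)
  have p': "p' \<in> hom C (Dom C p') (Dom C a')" using pb' by (auto simp: pullback_def hom_iff)
  have up: "Comp C a p = Comp C a' (Comp C u p)" "Comp C b q = Comp C b' (Comp C w q)"
    using Comp_assoc[OF C pq(1) u(1) a'] Comp_assoc[OF C pq(2) w(1) b'] u(2) w(2) by simp_all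
  note uph = Comp_in_hom[OF C pq(1) u(1)] and wqh = Comp_in_hom[OF C pq(2) w(1)]
  have "Comp C a' (Comp C u p) = Comp C b' (Comp C w q)" using up pq by simp
  from pullback_ex1[OF pb' uph wqh this]
  obtain t where t: "t \<in> hom C (Dom C p) (Dom C p')" "Comp C p' t = Comp C u p" by blast
  have "Comp C a p = Comp C (Comp C a' p') t"
    using Comp_assoc[OF C t(1) p' a'] t(2) up by simp
  moreover have "Dom C (Comp C a' p') = Dom C p'" "Dom C (Comp C a p) = Dom C p"
    using Comp_in_hom[OF C p' a'] Comp_in_hom[OF C pq(1), of a "Cod C a"] arr
    by (auto simp: hom_iff)
  ultimately have "factors_through C (Comp C a p) (Comp C a' p')"
    using t(1) by (auto simp: factors_through_def)
  then show "factors_through C (Comp C a p) c"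
    using factors_through_trans[OF C] 1(4) D arr by metis
next
  assume "factors_through C (Comp C a p) c"
  then show "sub_le C (sub_meet C (subobj C a) (subobj C b)) (subobj C c)"
    using self_in_subobj[OF C a] self_in_subobj[OF C b] self_in_subobj[OF C c] pb
    unfolding sub_le_def sub_meet_def by blast
qed

text \<open>The formal part of the theorem, valid in every category. For \<open>d\<close> itself to be
  transported intact, the transported arrow \<open>h \<circ> id = h\<close> has to represent a subobject; this is
  where \<open>h\<close> being monic enters.\<close>

lemma stable_iff_factors_consequences:
  assumes C: "category C" and d: "monic C d" and h: "monic C h"
    and cod: "Cod C d = Cod C m" and dom: "Dom C h = Dom C d"
    and stable: "\<And>a. monic C a \<Longrightarrow> Cod C a = Cod C m \<Longrightarrow>
      rho_stable C l m (subobj C a) \<longleftrightarrow> factors_through C a d"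
  shows "(\<forall>a. monic C a \<and> Cod C a = Cod C m \<longrightarrow>
            (rho_stable C l m (subobj C a) \<longleftrightarrow> sub_le C (subobj C a) (subobj C d)) \<and>
            (sub_le C (subobj C a) (subobj C d) \<longleftrightarrow> factors_through C a d)) \<and>
         Stab C l m = {A \<in> Sub C (Cod C m). sub_le C A (subobj C d)} \<and>
         transported_intact C l m d h (subobj C d) \<and>
         (\<forall>A. transported_intact C l m d h A \<longrightarrow> sub_le C A (subobj C d))"
proof -
  have le: "sub_le C (subobj C a) (subobj C d) \<longleftrightarrow> factors_through C a d" if "monic C a" for a
    by (rule sub_le_subobj_iff[OF C that d])
  have Stab: "Stab C l m = {A \<in> Sub C (Cod C m). sub_le C A (subobj C d)}"
    using le stable by (auto simp: Stab_def Sub_def)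
  have dh: "d \<in> hom C (Dom C d) (Cod C d)" "h \<in> hom C (Dom C d) (Cod C h)"
    using d h dom by (auto simp: monic_def hom_iff)
  have "subobj C d \<in> Stab C l m"
    using d cod le[OF d] factors_through_refl[OF C homD(1)[OF dh(1)]] by (auto simp: Stab Sub_def)
  moreover have "subobj C h \<in> Sub C (Cod C h)" using h by (auto simp: Sub_def)
  moreover have "Idn C (Dom C d) \<in> hom C (Dom C d) (Dom C d)"
    by (rule Idn_in_hom[OF C Dom_in_Obj[OF C homD(1)[OF dh(1)]]])
  moreover have "Comp C d (Idn C (Dom C d)) = d" "Comp C h (Idn C (Dom C d)) = h"
    using Comp_Idn[OF C] dh by blast+
  ultimately have "transported_to C l m d h (subobj C d) (subobj C h)"
    unfolding transported_to_def using self_in_subobj[OF C d] by metis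
  then show ?thesis
    using le stable Stab by (auto simp: transported_intact_def transported_to_def)
qed

section \<open>Set-valued functors over a fixed one, by elements\<close>

text \<open>An object of the slice is an arrow of the functor category, that is, a triple of a functor, its
  transformation into the base, and the base. The next definitions extract its sets, the functions
  between them and the values in the base, and then the components of a morphism of such
  objects.\<close>

definition app :: "'u set_arr \<Rightarrow> 'u \<Rightarrow> 'u" where
  "app f = fst (snd f)"

type_synonym ('o, 'a, 'u) setfun = "('o, 'a, 'u set, 'u set_arr) func"
type_synonym ('o, 'a, 'u) over = "('o, 'a, 'u set, 'u set_arr) nat_arr"

definition elems :: "('o, 'a, 'u) over \<Rightarrow> 'o \<Rightarrow> 'u set" where
  "elems p v = fst (fst p) v"

definition action :: "('o, 'a, 'u) over \<Rightarrow> 'a \<Rightarrow> 'u \<Rightarrow> 'u" where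
  "action p f = app (snd (fst p) f)"

definition label :: "('o, 'a, 'u) over \<Rightarrow> 'o \<Rightarrow> 'u \<Rightarrow> 'u" where
  "label p v = app (fst (snd p) v)"

definition component ::
    "('o, 'a, 'u) over \<times> ('o, 'a, 'u) over \<times> ('o, 'a, 'u) over \<Rightarrow> 'o \<Rightarrow> 'u \<Rightarrow> 'u" where
  "component \<phi> v = app (fst (snd (fst (snd \<phi>))) v)"

lemma set_hom_iff: "a \<in> hom set_cat A B \<longleftrightarrow> (\<exists>f \<in> A \<rightarrow>\<^sub>E B. a = (A, f, B))"
  by (auto simp: hom_def set_cat_def)

lemma set_hom_eqI:
  assumes "a \<in> hom set_cat A B" "b \<in> hom set_cat A B" "\<And>x. x \<in> A \<Longrightarrow> app a x = app b x"
  shows "a = b"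
  using assms by (auto simp: set_hom_iff app_def intro: PiE_ext)

lemma app_in: "a \<in> hom set_cat A B \<Longrightarrow> x \<in> A \<Longrightarrow> app a x \<in> B"
  by (auto simp: set_hom_iff app_def)

lemma app_Comp:
  "a \<in> hom set_cat A B \<Longrightarrow> x \<in> A \<Longrightarrow> app (Comp set_cat b a) x = app b (app a x)"
  unfolding set_hom_iff by (cases b) (auto simp: app_def set_cat_def compose_def)

lemma app_Idn: "x \<in> A \<Longrightarrow> app (Idn set_cat A) x = x"
  by (simp add: app_def set_cat_def)

text \<open>The source of all room needed inside the universe: products embed directly, and coproducts as
  pairs tagged by one of two distinct elements.\<close>

lemma ex_pairing: "\<exists>e :: 'u::infinite \<times> 'u \<Rightarrow> 'u. inj e"
  using card_of_Times_same_infinite[OF infinite_UNIV[where ?'a = 'u]]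
  unfolding card_of_ordIso[symmetric] by (auto dest: bij_betw_imp_inj_on)

locale set_functors_over =
  fixes J :: "('o, 'a) cat" and \<Sigma> :: "('o, 'a, 'u::infinite) setfun"
  assumes J: "category J" and \<Sigma>: "is_functor J set_cat \<Sigma>"
begin

abbreviation C where "C \<equiv> slice (functor_cat J set_cat) \<Sigma>"

lemma C: "category C"
  by (intro category_slice category_functor_cat J category_set_cat)

text \<open>The elementwise axioms for an object of the slice and, below, for a morphism. By
  \<open>wf_over_Obj\<close> and \<open>ex_over\<close>, \<open>wf_map_component\<close> and \<open>ex_map\<close>, they describe objects and morphisms
  exactly, up to values outside the relevant sets. Together with \<open>hom_eqI\<close> and the components of
  composites and identities, the later sections rely on this description alone.\<close>

definition wf_over :: "('o \<Rightarrow> 'u set) \<Rightarrow> ('a \<Rightarrow> 'u \<Rightarrow> 'u) \<Rightarrow> ('o \<Rightarrow> 'u \<Rightarrow> 'u) \<Rightarrow> bool" where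
  "wf_over X A \<pi> \<longleftrightarrow>
     (\<forall>f\<in>Arr J. \<forall>x\<in>X (Dom J f). A f x \<in> X (Cod J f)) \<and>
     (\<forall>v\<in>Obj J. \<forall>x\<in>X v. A (Idn J v) x = x) \<and>
     (\<forall>f\<in>Arr J. \<forall>g\<in>Arr J. Cod J f = Dom J g \<longrightarrow>
        (\<forall>x\<in>X (Dom J f). A (Comp J g f) x = A g (A f x))) \<and>
     (\<forall>v\<in>Obj J. \<forall>x\<in>X v. \<pi> v x \<in> fst \<Sigma> v) \<and>
     (\<forall>f\<in>Arr J. \<forall>x\<in>X (Dom J f). \<pi> (Cod J f) (A f x) = app (snd \<Sigma> f) (\<pi> (Dom J f) x))"

definition wf_map ::
  "('o, 'a, 'u) over \<Rightarrow> ('o, 'a, 'u) over \<Rightarrow> ('o \<Rightarrow> 'u \<Rightarrow> 'u) \<Rightarrow> bool" where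
  "wf_map p q t \<longleftrightarrow>
     (\<forall>v\<in>Obj J. \<forall>x\<in>elems p v. t v x \<in> elems q v \<and> label q v (t v x) = label p v x) \<and>
     (\<forall>f\<in>Arr J. \<forall>x\<in>elems p (Dom J f). t (Cod J f) (action p f x) = action q f (t (Dom J f) x))"

lemma Obj_C: "p \<in> Obj C \<longleftrightarrow> (\<exists>X \<pi>. p = (X, \<pi>, \<Sigma>) \<and> is_functor J set_cat X \<and>
    natural_transf J set_cat X \<pi> \<Sigma>)"
  using \<Sigma> by (auto simp: slice_def functor_cat_def)

lemma hom_C: "\<phi> \<in> hom C p q \<longleftrightarrow> p \<in> Obj C \<and> q \<in> Obj C \<and> (\<exists>\<tau>. \<phi> = (p, (fst p, \<tau>, fst q), q) \<and>
    natural_transf J set_cat (fst p) \<tau> (fst q) \<and>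
    fst (snd p) = restrict (\<lambda>v. Comp set_cat (fst (snd q) v) (\<tau> v)) (Obj J))"
  using \<Sigma> by (auto simp: slice_def functor_cat_def hom_def)

lemma functor_hom: "is_functor J set_cat X \<Longrightarrow> f \<in> Arr J \<Longrightarrow>
    snd X f \<in> hom set_cat (fst X (Dom J f)) (fst X (Cod J f))"
  by (simp add: is_functor_def)

lemma transf_hom: "natural_transf J set_cat X t Y \<Longrightarrow> v \<in> Obj J \<Longrightarrow>
    t v \<in> hom set_cat (fst X v) (fst Y v)"
  by (simp add: natural_transf_def)

lemma transf_app:
  assumes "is_functor J set_cat X" "natural_transf J set_cat X t Y" "f \<in> Arr J" "x \<in> fst X (Dom J f)"
  shows "app (t (Cod J f)) (app (snd X f) x) = app (snd Y f) (app (t (Dom J f)) x)"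
proof -
  have "Comp set_cat (t (Cod J f)) (snd X f) = Comp set_cat (snd Y f) (t (Dom J f))"
    using assms by (simp add: natural_transf_def)
  then show ?thesis
    using app_Comp[OF functor_hom[OF assms(1,3)] assms(4)]
      app_Comp[OF transf_hom[OF assms(2) Dom_in_Obj[OF J assms(3)]] assms(4)] by metis
qed

lemma natural_transfI:
  assumes X: "is_functor J set_cat X" and Y: "is_functor J set_cat Y"
    and t: "t \<in> extensional (Obj J)" "\<And>v. v \<in> Obj J \<Longrightarrow> t v \<in> hom set_cat (fst X v) (fst Y v)"
    and n: "\<And>f x. f \<in> Arr J \<Longrightarrow> x \<in> fst X (Dom J f) \<Longrightarrow>
      app (t (Cod J f)) (app (snd X f) x) = app (snd Y f) (app (t (Dom J f)) x)"
  shows "natural_transf J set_cat X t Y"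
  unfolding natural_transf_def
proof (intro conjI ballI t)
  fix f assume f: "f \<in> Arr J"
  note o = t(2)[OF Dom_in_Obj[OF J f]] t(2)[OF Cod_in_Obj[OF J f]]
  note F = functor_hom[OF X f] functor_hom[OF Y f]
  show "Comp set_cat (t (Cod J f)) (snd X f) = Comp set_cat (snd Y f) (t (Dom J f))"
    by (rule set_hom_eqI[OF Comp_in_hom[OF category_set_cat F(1) o(2)]
        Comp_in_hom[OF category_set_cat o(1) F(2)]])
      (simp add: app_Comp[OF F(1)] app_Comp[OF o(1)] n f)
qed

lemma wf_over_Obj:
  assumes "p \<in> Obj C" shows "wf_over (elems p) (action p) (label p)"
proof -
  obtain X \<pi> where p: "p = (X, \<pi>, \<Sigma>)" and X: "is_functor J set_cat X"
    and t: "natural_transf J set_cat X \<pi> \<Sigma>"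
    using assms by (auto simp: Obj_C)
  have "snd X (Idn J v) = Idn set_cat (fst X v)" if "v \<in> Obj J" for v
    using X that by (simp add: is_functor_def)
  moreover have "snd X (Comp J g f) = Comp set_cat (snd X g) (snd X f)"
    if "f \<in> Arr J" "g \<in> Arr J" "Cod J f = Dom J g" for f g
    using X that by (simp add: is_functor_def)
  ultimately show ?thesis
    using app_in[OF functor_hom[OF X]] app_in[OF transf_hom[OF t]] transf_app[OF X t]
    by (simp add: wf_over_def elems_def action_def label_def p app_Idn app_Comp[OF functor_hom[OF X]])
qed

lemma ex_over:
  assumes w: "wf_over X A \<pi>"
  obtains p where "p \<in> Obj C" "\<And>v. v \<in> Obj J \<Longrightarrow> elems p v = X v"
    "\<And>v x. v \<in> Obj J \<Longrightarrow> x \<in> X v \<Longrightarrow> label p v x = \<pi> v x"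
    "\<And>f x. f \<in> Arr J \<Longrightarrow> x \<in> X (Dom J f) \<Longrightarrow> action p f x = A f x"
proof -
  define F where "F = (restrict X (Obj J),
    restrict (\<lambda>f. (X (Dom J f), restrict (A f) (X (Dom J f)), X (Cod J f))) (Arr J))"
  define t where "t = restrict (\<lambda>v. (X v, restrict (\<pi> v) (X v), fst \<Sigma> v)) (Obj J)"
  note D = Dom_in_Obj[OF J] Cod_in_Obj[OF J]
  have o: "fst F v = X v" if "v \<in> Obj J" for v using that by (simp add: F_def)
  have a: "app (snd F f) x = A f x" if "f \<in> Arr J" "x \<in> X (Dom J f)" for f x
    using that by (simp add: F_def app_def)
  have h: "snd F f \<in> hom set_cat (X (Dom J f)) (X (Cod J f))" if "f \<in> Arr J" for f
    using that w by (auto simp: F_def set_hom_iff wf_over_def)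
  have F: "is_functor J set_cat F"
    unfolding is_functor_def
  proof (intro conjI ballI impI)
    show "fst F \<in> Obj J \<rightarrow>\<^sub>E Obj set_cat" by (auto simp: F_def set_cat_def)
    show "snd F \<in> extensional (Arr J)" by (auto simp: F_def)
    show "snd F f \<in> hom set_cat (fst F (Dom J f)) (fst F (Cod J f))" if "f \<in> Arr J" for f
      using h[OF that] D[OF that] by (simp add: o)
    fix v assume v: "v \<in> Obj J"
    note i = Idn_in_hom[OF J v]
    have so: "X v \<in> Obj set_cat" by (simp add: set_cat_def)
    show "snd F (Idn J v) = Idn set_cat (fst F v)"
      using h[of "Idn J v"] i v w Idn_in_hom[OF category_set_cat so]
      by (intro set_hom_eqI[of _ "X v" "X v"])
        (auto simp: o hom_iff a app_Idn wf_over_def)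
  next
    fix f g assume fg: "f \<in> Arr J" "g \<in> Arr J" "Cod J f = Dom J g"
    have gf: "Comp J g f \<in> hom J (Dom J f) (Cod J g)"
      using Comp_in_hom[OF J, of f _ _ g] fg by (simp add: hom_iff)
    note c = Comp_in_hom[OF category_set_cat h[OF fg(1), unfolded fg(3)] h[OF fg(2)]]
    show "snd F (Comp J g f) = Comp set_cat (snd F g) (snd F f)"
      by (rule set_hom_eqI[OF _ c])
        (use h[of "Comp J g f"] gf fg w in
          \<open>auto simp: hom_iff[of _ J] a app_Comp[OF h] wf_over_def\<close>)
  qed
  have T: "natural_transf J set_cat F t \<Sigma>"
    by (rule natural_transfI[OF F \<Sigma>])
      (use w D in \<open>auto simp: t_def o a app_def[of "(_, _)"] set_hom_iff wf_over_def\<close>)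
  show thesis
    by (rule that[of "(F, t, \<Sigma>)"])
      (use F T in \<open>auto simp: Obj_C elems_def label_def action_def o a, simp add: t_def app_def\<close>)
qed

lemma wf_map_component:
  assumes "\<phi> \<in> hom C p q" shows "p \<in> Obj C" "q \<in> Obj C" "wf_map p q (component \<phi>)"
proof -
  obtain \<tau> where \<phi>: "\<phi> = (p, (fst p, \<tau>, fst q), q)" and p: "p \<in> Obj C" and q: "q \<in> Obj C"
    and t: "natural_transf J set_cat (fst p) \<tau> (fst q)"
    and l: "fst (snd p) = restrict (\<lambda>v. Comp set_cat (fst (snd q) v) (\<tau> v)) (Obj J)"
    using assms by (auto simp: hom_C)
  show "p \<in> Obj C" "q \<in> Obj C" by fact+
  have F: "is_functor J set_cat (fst p)" using p by (auto simp: Obj_C)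
  show "wf_map p q (component \<phi>)"
    using app_in[OF transf_hom[OF t]] transf_app[OF F t] app_Comp[OF transf_hom[OF t]]
    by (simp add: wf_map_def \<phi> component_def elems_def action_def label_def l)
qed

lemma ex_map:
  assumes p: "p \<in> Obj C" and q: "q \<in> Obj C" and w: "wf_map p q t"
  obtains \<phi> where "\<phi> \<in> hom C p q"
    "\<And>v x. v \<in> Obj J \<Longrightarrow> x \<in> elems p v \<Longrightarrow> component \<phi> v x = t v x"
proof -
  define \<tau> where "\<tau> = restrict (\<lambda>v. (elems p v, restrict (t v) (elems p v), elems q v)) (Obj J)"
  have h: "\<tau> v \<in> hom set_cat (fst (fst p) v) (fst (fst q) v)" if "v \<in> Obj J" for v
    using that w by (auto simp: \<tau>_def set_hom_iff wf_map_def elems_def)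
  have a: "app (\<tau> v) x = t v x" if "v \<in> Obj J" "x \<in> fst (fst p) v" for v x
    using that by (simp add: \<tau>_def app_def elems_def)
  obtain X \<pi> Y \<rho> where pq: "p = (X, \<pi>, \<Sigma>)" "q = (Y, \<rho>, \<Sigma>)" "is_functor J set_cat X"
    "is_functor J set_cat Y" "natural_transf J set_cat X \<pi> \<Sigma>" "natural_transf J set_cat Y \<rho> \<Sigma>"
    using p q by (auto simp: Obj_C)
  have T: "natural_transf J set_cat (fst p) \<tau> (fst q)"
  proof (rule natural_transfI)
    show "is_functor J set_cat (fst p)" "is_functor J set_cat (fst q)" using pq by simp_all
    show "\<tau> \<in> extensional (Obj J)" by (simp add: \<tau>_def)
    show "\<tau> v \<in> hom set_cat (fst (fst p) v) (fst (fst q) v)" if "v \<in> Obj J" for v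
      by (rule h[OF that])
    fix f x assume f: "f \<in> Arr J" and x: "x \<in> fst (fst p) (Dom J f)"
    have "app (snd (fst p) f) x \<in> fst (fst p) (Cod J f)"
      using app_in[OF functor_hom[OF pq(3) f]] x pq(1) by simp
    then show "app (\<tau> (Cod J f)) (app (snd (fst p) f) x) = app (snd (fst q) f) (app (\<tau> (Dom J f)) x)"
      using w f x Dom_in_Obj[OF J f] Cod_in_Obj[OF J f]
      by (simp add: a wf_map_def elems_def action_def)
  qed
  have "\<pi> v = restrict (\<lambda>v. Comp set_cat (\<rho> v) (\<tau> v)) (Obj J) v" for v
  proof (cases "v \<in> Obj J")
    case True
    note k = h[OF True] and r = transf_hom[OF pq(6) True] and s = transf_hom[OF pq(5) True]
    have "app (\<pi> v) x = app (Comp set_cat (\<rho> v) (\<tau> v)) x" if x: "x \<in> fst X v" for x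
    proof -
      have "label q v (t v x) = label p v x"
        using w True x pq(1) by (simp add: wf_map_def elems_def)
      then show ?thesis
        using app_Comp[OF k, of x "\<rho> v"] a[OF True] x pq(1,2) by (simp add: label_def)
    qed
    then have "\<pi> v = Comp set_cat (\<rho> v) (\<tau> v)"
      using Comp_in_hom[OF category_set_cat k] r pq(1,2) by (intro set_hom_eqI[OF s]) auto
    then show ?thesis using True by simp
  next
    case False
    then show ?thesis using pq(5) by (auto simp: natural_transf_def extensional_def)
  qed
  then have "(p, (fst p, \<tau>, fst q), q) \<in> hom C p q"
    using T p q by (auto simp: hom_C pq(1,2))
  then show thesis
    by (rule that) (simp add: component_def a elems_def)
qed

lemma hom_eqI:
  assumes "\<phi> \<in> hom C p q" "\<psi> \<in> hom C p q"
    and e: "\<And>v x. v \<in> Obj J \<Longrightarrow> x \<in> elems p v \<Longrightarrow> component \<phi> v x = component \<psi> v x"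
  shows "\<phi> = \<psi>"
proof -
  obtain s t where 1: "\<phi> = (p, (fst p, s, fst q), q)" "natural_transf J set_cat (fst p) s (fst q)"
    "\<psi> = (p, (fst p, t, fst q), q)" "natural_transf J set_cat (fst p) t (fst q)"
    using assms(1,2) by (auto simp: hom_C)
  have "s v = t v" for v
  proof (cases "v \<in> Obj J")
    case True
    show ?thesis
      by (rule set_hom_eqI[OF transf_hom[OF 1(2) True] transf_hom[OF 1(4) True]])
        (use e[OF True] in \<open>simp add: 1(1,3) component_def elems_def\<close>)
  next
    case False
    then show ?thesis using 1(2,4) by (auto simp: natural_transf_def extensional_def)
  qed
  then show ?thesis by (auto simp: 1(1,3))
qed

lemma component_Comp:
  assumes "\<phi> \<in> hom C p q" "\<psi> \<in> hom C q r" "v \<in> Obj J" "x \<in> elems p v"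
  shows "component (Comp C \<psi> \<phi>) v x = component \<psi> v (component \<phi> v x)"
proof -
  obtain s t where 1: "\<phi> = (p, (fst p, s, fst q), q)" "natural_transf J set_cat (fst p) s (fst q)"
    "\<psi> = (q, (fst q, t, fst r), r)"
    using assms(1,2) by (auto simp: hom_C)
  show ?thesis
    using app_Comp[OF transf_hom[OF 1(2) assms(3)]] assms(3,4)
    by (simp add: 1(1,3) slice_def functor_cat_def component_def elems_def)
qed

lemma component_Idn:
  assumes "p \<in> Obj C" "v \<in> Obj J" "x \<in> elems p v"
  shows "component (Idn C p) v x = x"
  using assms by (auto simp: Obj_C slice_def functor_cat_def component_def elems_def app_Idn)

lemma
  assumes "p \<in> Obj C"
  shows action_in: "f \<in> Arr J \<Longrightarrow> x \<in> elems p (Dom J f) \<Longrightarrow> action p f x \<in> elems p (Cod J f)"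
    and action_Idn: "v \<in> Obj J \<Longrightarrow> x \<in> elems p v \<Longrightarrow> action p (Idn J v) x = x"
    and action_Comp: "f \<in> Arr J \<Longrightarrow> g \<in> Arr J \<Longrightarrow> Cod J f = Dom J g \<Longrightarrow> x \<in> elems p (Dom J f) \<Longrightarrow>
      action p (Comp J g f) x = action p g (action p f x)"
    and label_in: "v \<in> Obj J \<Longrightarrow> x \<in> elems p v \<Longrightarrow> label p v x \<in> fst \<Sigma> v"
    and label_action: "f \<in> Arr J \<Longrightarrow> x \<in> elems p (Dom J f) \<Longrightarrow>
      label p (Cod J f) (action p f x) = app (snd \<Sigma> f) (label p (Dom J f) x)"
  using wf_over_Obj[OF assms] by (simp_all add: wf_over_def)

lemma
  assumes "\<phi> \<in> hom C p q"
  shows component_in: "v \<in> Obj J \<Longrightarrow> x \<in> elems p v \<Longrightarrow> component \<phi> v x \<in> elems q v"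
    and label_component: "v \<in> Obj J \<Longrightarrow> x \<in> elems p v \<Longrightarrow> label q v (component \<phi> v x) = label p v x"
    and component_action: "f \<in> Arr J \<Longrightarrow> x \<in> elems p (Dom J f) \<Longrightarrow>
      component \<phi> (Cod J f) (action p f x) = action q f (component \<phi> (Dom J f) x)"
  using wf_map_component[OF assms] by (simp_all add: wf_map_def)

definition injective where
  "injective \<phi> \<longleftrightarrow> (\<forall>v\<in>Obj J. inj_on (component \<phi> v) (elems (Dom C \<phi>) v))"

definition range_at where
  "range_at \<phi> v = component \<phi> v ` elems (Dom C \<phi>) v"

lemma range_at_eq:
  assumes "\<phi> \<in> hom C X Y" shows "range_at \<phi> v = component \<phi> v ` elems X v"
  by (simp add: range_at_def homD(2)[OF assms])

lemma injectiveD: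
  assumes "injective \<phi>" "\<phi> \<in> hom C X Y" "v \<in> Obj J" shows "inj_on (component \<phi> v) (elems X v)"
  using assms(1,3) by (simp add: injective_def homD(2)[OF assms(2)])

section \<open>Monomorphisms and factorisation\<close>

text \<open>The pullback is formed object by object as the set of coded matching pairs. The elementwise
  conclusion is the form in which it serves both for kernel pairs and for meets.\<close>

lemma ex_pullback:
  assumes f: "f \<in> hom C X Z" and g: "g \<in> hom C Y Z"
  obtains P p q where "p \<in> hom C P X" "q \<in> hom C P Y" "pullback C f g p q"
    "\<And>v x y. v \<in> Obj J \<Longrightarrow> x \<in> elems X v \<Longrightarrow> y \<in> elems Y v \<Longrightarrow>
      component f v x = component g v y \<Longrightarrow>
      \<exists>z\<in>elems P v. component p v z = x \<and> component q v z = y"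
proof -
  obtain e :: "'u \<times> 'u \<Rightarrow> 'u" where e: "inj e"
    using ex_pairing by blast
  define l where "l z = fst (inv e z)" for z
  define r where "r z = snd (inv e z)" for z
  have lr [simp]: "l (e (x, y)) = x" "r (e (x, y)) = y" for x y
    using e by (simp_all add: l_def r_def)
  define S where "S v = {e (x, y) |x y. x \<in> elems X v \<and> y \<in> elems Y v \<and>
    component f v x = component g v y}" for v
  have X: "X \<in> Obj C" and Y: "Y \<in> Obj C"
    using wf_map_component f g by blast+
  note D = Dom_in_Obj[OF J] Cod_in_Obj[OF J]
  have "wf_over S (\<lambda>k z. e (action X k (l z), action Y k (r z))) (\<lambda>v z. label X v (l z))"
    unfolding wf_over_def S_def
    by (auto intro!: exI simp: D action_in[OF X] action_in[OF Y] action_Idn[OF X] action_Idn[OF Y]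
      action_Comp[OF X] action_Comp[OF Y] label_in[OF X] label_action[OF X]
      component_action[OF f] component_action[OF g])
  then obtain P where P: "P \<in> Obj C" "\<And>v. v \<in> Obj J \<Longrightarrow> elems P v = S v"
    "\<And>v x. v \<in> Obj J \<Longrightarrow> x \<in> S v \<Longrightarrow> label P v x = label X v (l x)"
    "\<And>k x. k \<in> Arr J \<Longrightarrow> x \<in> S (Dom J k) \<Longrightarrow> action P k x = e (action X k (l x), action Y k (r x))"
    using ex_over by blast
  have lab: "label Y v y = label X v x" if "v \<in> Obj J" "x \<in> elems X v" "y \<in> elems Y v"
    "component f v x = component g v y" for v x y
    using label_component[OF f that(1,2)] label_component[OF g that(1,3)] that(4) by simp
  have "wf_map P X (\<lambda>_. l)"
    unfolding wf_map_def by (auto simp: P D) (auto simp: S_def)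
  then obtain p where p: "p \<in> hom C P X"
    "\<And>v x. v \<in> Obj J \<Longrightarrow> x \<in> elems P v \<Longrightarrow> component p v x = l x"
    using ex_map[OF P(1) X] by blast
  have "wf_map P Y (\<lambda>_. r)"
    unfolding wf_map_def by (auto simp: P D) (auto simp: S_def intro: lab)
  then obtain q where q: "q \<in> hom C P Y"
    "\<And>v x. v \<in> Obj J \<Longrightarrow> x \<in> elems P v \<Longrightarrow> component q v x = r x"
    using ex_map[OF P(1) Y] by blast
  have "Comp C f p = Comp C g q"
    by (rule hom_eqI[OF Comp_in_hom[OF C p(1) f] Comp_in_hom[OF C q(1) g]])
      (auto simp: component_Comp[OF p(1) f] component_Comp[OF q(1) g] p q P, auto simp: S_def)
  moreover have "\<exists>!u. u \<in> hom C W P \<and> Comp C p u = p' \<and> Comp C q u = q'"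
    if p': "p' \<in> hom C W X" and q': "q' \<in> hom C W Y" and eq: "Comp C f p' = Comp C g q'"
    for W p' q'
  proof (rule ex_ex1I)
    have W: "W \<in> Obj C" using wf_map_component p' by blast
    have c: "component f v (component p' v x) = component g v (component q' v x)"
      if "v \<in> Obj J" "x \<in> elems W v" for v x
      using eq component_Comp[OF p' f that] component_Comp[OF q' g that] by simp
    have s: "e (component p' v x, component q' v x) \<in> S v" if "v \<in> Obj J" "x \<in> elems W v" for v x
      using c[OF that] component_in[OF p' that] component_in[OF q' that] by (auto simp: S_def)
    have "wf_map W P (\<lambda>v x. e (component p' v x, component q' v x))"
      unfolding wf_map_def
      by (auto simp: P D s label_component[OF p'] component_action[OF p'] component_action[OF q'])
    then obtain u where u: "u \<in> hom C W P"
      "\<And>v x. v \<in> Obj J \<Longrightarrow> x \<in> elems W v \<Longrightarrow> component u v x = e (component p' v x, component q' v x)"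
      using ex_map[OF W P(1)] by blast
    have "Comp C p u = p'"
      by (rule hom_eqI[OF Comp_in_hom[OF C u(1) p(1)] p'])
        (simp add: component_Comp[OF u(1) p(1)] u p P s)
    moreover have "Comp C q u = q'"
      by (rule hom_eqI[OF Comp_in_hom[OF C u(1) q(1)] q'])
        (simp add: component_Comp[OF u(1) q(1)] u q P s)
    ultimately show "\<exists>u. u \<in> hom C W P \<and> Comp C p u = p' \<and> Comp C q u = q'" using u by blast
  next
    fix u w assume u: "u \<in> hom C W P \<and> Comp C p u = p' \<and> Comp C q u = q'"
      and w: "w \<in> hom C W P \<and> Comp C p w = p' \<and> Comp C q w = q'"
    then have uw: "u \<in> hom C W P" "w \<in> hom C W P" by auto
    show "u = w"
    proof (rule hom_eqI[OF uw])
      fix v x assume v: "v \<in> Obj J" "x \<in> elems W v"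
      have "l (component u v x) = l (component w v x)"
        using component_Comp[OF uw(1) p(1) v] component_Comp[OF uw(2) p(1) v] u w
          p(2)[OF v(1) component_in[OF uw(1) v]] p(2)[OF v(1) component_in[OF uw(2) v]] by simp
      moreover have "r (component u v x) = r (component w v x)"
        using component_Comp[OF uw(1) q(1) v] component_Comp[OF uw(2) q(1) v] u w
          q(2)[OF v(1) component_in[OF uw(1) v]] q(2)[OF v(1) component_in[OF uw(2) v]] by simp
      ultimately show "component u v x = component w v x"
        using component_in[OF uw(1) v] component_in[OF uw(2) v] by (auto simp: P v S_def)
    qed
  qed
  ultimately have "pullback C f g p q"
    by (intro pullbackI[OF f g p(1) q(1)]) blast+
  moreover have "\<exists>z\<in>elems P v. component p v z = x \<and> component q v z = y"
    if "v \<in> Obj J" "x \<in> elems X v" "y \<in> elems Y v" "component f v x = component g v y" for v x y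
  proof -
    have "e (x, y) \<in> elems P v" using that by (auto simp: P S_def)
    then show ?thesis using that p q by (intro bexI[of _ "e (x, y)"]) auto
  qed
  ultimately show thesis using that p q by blast
qed

text \<open>For the forward direction, cancelling a monomorphism on its kernel pair shows that the two
  projections agree, so two elements with equal images, which form an element of the kernel pair,
  are equal.\<close>

lemma monic_iff_injective:
  assumes f: "f \<in> hom C X Y" shows "monic C f \<longleftrightarrow> injective f"
proof
  assume m: "monic C f"
  obtain P p q where pq: "p \<in> hom C P X" "q \<in> hom C P X" "pullback C f f p q"
    and z: "\<And>v x y. v \<in> Obj J \<Longrightarrow> x \<in> elems X v \<Longrightarrow> y \<in> elems X v \<Longrightarrow>
      component f v x = component f v y \<Longrightarrow>
      \<exists>z\<in>elems P v. component p v z = x \<and> component q v z = y"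
    by (rule ex_pullback[OF f f], rule that)
  have "Comp C f p = Comp C f q" using pq(3) unfolding pullback_def by blast
  then have "p = q" using monic_cancel[OF m] pq(1,2) homD(2)[OF f] by simp
  then show "injective f" using z homD(2)[OF f] by (auto simp: injective_def inj_on_def)
next
  assume i: "injective f"
  show "monic C f"
  proof (rule monicI[OF f], rule hom_eqI)
    fix W g h assume g: "g \<in> hom C W X" and h: "h \<in> hom C W X" and eq: "Comp C f g = Comp C f h"
    show "g \<in> hom C W X" "h \<in> hom C W X" by fact+
    fix v x assume v: "v \<in> Obj J" "x \<in> elems W v"
    have "component f v (component g v x) = component f v (component h v x)"
      using component_Comp[OF g f v] component_Comp[OF h f v] eq by simp
    then show "component g v x = component h v x"
      using i v component_in[OF g v] component_in[OF h v] homD(2)[OF f]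
      by (auto simp: injective_def inj_on_def)
  qed
qed

text \<open>The pointwise lift along an injective \<open>g\<close> is unique, and this uniqueness makes it natural.\<close>

lemma factors_through_iff_range:
  assumes f: "f \<in> hom C X Z" and g: "g \<in> hom C Y Z" and i: "injective g"
  shows "factors_through C f g \<longleftrightarrow> (\<forall>v\<in>Obj J. range_at f v \<subseteq> range_at g v)"
proof
  assume "factors_through C f g"
  then obtain u where u: "u \<in> hom C X Y" "f = Comp C g u"
    using f g by (auto simp: factors_through_def hom_iff)
  then show "\<forall>v\<in>Obj J. range_at f v \<subseteq> range_at g v"
    using component_Comp[OF u(1) g] component_in[OF u(1)] homD(2)[OF f] homD(2)[OF g]
    by (auto simp: range_at_def)
next
  assume r: "\<forall>v\<in>Obj J. range_at f v \<subseteq> range_at g v"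
  have X: "X \<in> Obj C" and Y: "Y \<in> Obj C"
    using wf_map_component f g by blast+
  define t where "t v x = inv_into (elems Y v) (component g v) (component f v x)" for v x
  have t: "t v x \<in> elems Y v" "component g v (t v x) = component f v x"
    if "v \<in> Obj J" "x \<in> elems X v" for v x
    using r that homD(2)[OF f] homD(2)[OF g]
    by (auto simp: t_def range_at_def intro!: inv_into_into f_inv_into_f)
  have inj: "y = y'" if "v \<in> Obj J" "y \<in> elems Y v" "y' \<in> elems Y v"
    "component g v y = component g v y'" for v y y'
    using i that homD(2)[OF g] by (auto simp: injective_def inj_on_def)
  note D = Dom_in_Obj[OF J] Cod_in_Obj[OF J]
  have "wf_map X Y t"
    unfolding wf_map_def
  proof (intro conjI ballI t)
    fix v x assume v: "v \<in> Obj J" "x \<in> elems X v"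
    show "label Y v (t v x) = label X v x"
      using label_component[OF g v(1) t(1)[OF v]] label_component[OF f v] t(2)[OF v] by simp
  next
    fix k x assume k: "k \<in> Arr J" "x \<in> elems X (Dom J k)"
    show "t (Cod J k) (action X k x) = action Y k (t (Dom J k) x)"
      by (rule inj[of "Cod J k"])
        (simp_all add: D k t action_in[OF X] action_in[OF Y] component_action[OF g] component_action[OF f])
  qed
  then obtain u where u: "u \<in> hom C X Y"
    "\<And>v x. v \<in> Obj J \<Longrightarrow> x \<in> elems X v \<Longrightarrow> component u v x = t v x"
    using ex_map[OF X Y] by blast
  have "f = Comp C g u"
    by (rule hom_eqI[OF f Comp_in_hom[OF C u(1) g]])
      (simp add: component_Comp[OF u(1) g] u t)
  then show "factors_through C f g"
    using u(1) homD(2)[OF f] homD(2)[OF g] by (auto simp: factors_through_def)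
qed

lemma meet_le_iff_range:
  assumes a: "a \<in> hom C X G" and b: "b \<in> hom C Y G" and c: "c \<in> hom C Z G"
    and mono: "monic C a" "monic C b" "monic C c"
  shows "sub_le C (sub_meet C (subobj C a) (subobj C b)) (subobj C c) \<longleftrightarrow>
    (\<forall>v\<in>Obj J. range_at a v \<inter> range_at b v \<subseteq> range_at c v)"
proof -
  obtain P p q where p: "p \<in> hom C P X" and q: "q \<in> hom C P Y" and pb: "pullback C a b p q"
    and z: "\<And>v x y. v \<in> Obj J \<Longrightarrow> x \<in> elems X v \<Longrightarrow> y \<in> elems Y v \<Longrightarrow>
      component a v x = component b v y \<Longrightarrow>
      \<exists>z\<in>elems P v. component p v z = x \<and> component q v z = y"
    by (rule ex_pullback[OF a b], rule that)
  have eq: "Comp C a p = Comp C b q" using pb unfolding pullback_def by blast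
  note ap = Comp_in_hom[OF C p a]
  have "range_at (Comp C a p) v = range_at a v \<inter> range_at b v" if v: "v \<in> Obj J" for v
  proof (intro equalityI subsetI)
    fix g assume "g \<in> range_at a v \<inter> range_at b v"
    then obtain x y where xy: "x \<in> elems X v" "g = component a v x" "y \<in> elems Y v" "g = component b v y"
      by (auto simp: range_at_eq[OF a] range_at_eq[OF b])
    then obtain w where "w \<in> elems P v" "component p v w = x" using z[OF v xy(1,3)] by auto
    then show "g \<in> range_at (Comp C a p) v"
      using xy(2) component_Comp[OF p a v] by (auto simp: range_at_eq[OF ap])
  next
    fix g assume "g \<in> range_at (Comp C a p) v"
    then obtain w where w: "w \<in> elems P v" "g = component (Comp C a p) v w"
      by (auto simp: range_at_eq[OF ap])
    then have "g = component a v (component p v w)" "g = component b v (component q v w)"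
      using component_Comp[OF p a v w(1)] component_Comp[OF q b v w(1)] eq by simp_all
    then show "g \<in> range_at a v \<inter> range_at b v"
      using component_in[OF p v w(1)] component_in[OF q v w(1)]
      unfolding range_at_eq[OF a] range_at_eq[OF b] by blast
  qed
  then show ?thesis
    using sub_le_meet_iff[OF C mono pb] factors_through_iff_range[OF ap c]
      mono(3) monic_iff_injective[OF c] by simp
qed

section \<open>Pushouts along monomorphisms\<close>

text \<open>Both legs of the pushout factor through the union \<open>M\<close> of their images, so the universal property
  gives \<open>u : G \<rightarrow> M\<close>. Following \<open>u\<close> by the inclusion \<open>i\<close> fixes both legs and therefore is the
  identity of \<open>G\<close>, which puts every element of \<open>G\<close> into \<open>M\<close>.\<close>

lemma pushout_jointly_surjective:
  assumes po: "pushout C f g p q" and v: "v \<in> Obj J"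
  shows "elems (Cod C p) v = range_at p v \<union> range_at q v"
proof -
  define L D G where "L = Cod C f" and "D = Cod C g" and "G = Cod C p"
  have f: "f \<in> hom C (Dom C f) L" and g: "g \<in> hom C (Dom C f) D"
    and p: "p \<in> hom C L G" and q: "q \<in> hom C D G" and pfqg: "Comp C p f = Comp C q g"
    using pushout_homs[OF po] by (simp_all add: L_def D_def G_def)
  have ob: "L \<in> Obj C" "D \<in> Obj C" "G \<in> Obj C" using wf_map_component p q by blast+
  define I where "I v = range_at p v \<union> range_at q v" for v
  have I: "I v = component p v ` elems L v \<union> component q v ` elems D v" for v
    using homD(2)[OF p] homD(2)[OF q] by (simp add: I_def range_at_def)
  have sub: "x \<in> elems G v" if "v \<in> Obj J" "x \<in> I v" for v x
    using that component_in[OF p] component_in[OF q] by (auto simp: I)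
  note J' = Dom_in_Obj[OF J] Cod_in_Obj[OF J]
  have act: "action G k x \<in> I (Cod J k)" if "k \<in> Arr J" "x \<in> I (Dom J k)" for k x
    using that component_action[OF p that(1), symmetric] component_action[OF q that(1), symmetric]
      action_in[OF ob(1) that(1)] action_in[OF ob(2) that(1)] unfolding I by auto
  have "wf_over I (action G) (label G)"
    unfolding wf_over_def
    using act sub J' action_Idn[OF ob(3)] action_Comp[OF ob(3)] label_in[OF ob(3)]
      label_action[OF ob(3)] by simp
  then obtain M where M: "M \<in> Obj C" "\<And>v. v \<in> Obj J \<Longrightarrow> elems M v = I v"
    "\<And>v x. v \<in> Obj J \<Longrightarrow> x \<in> I v \<Longrightarrow> label M v x = label G v x"
    "\<And>k x. k \<in> Arr J \<Longrightarrow> x \<in> I (Dom J k) \<Longrightarrow> action M k x = action G k x"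
    using ex_over by blast
  have "wf_map M G (\<lambda>_ x. x)" unfolding wf_map_def using M sub J' by simp
  then obtain i where i: "i \<in> hom C M G"
    "\<And>v x. v \<in> Obj J \<Longrightarrow> x \<in> elems M v \<Longrightarrow> component i v x = x"
    using ex_map[OF M(1) ob(3)] by blast
  have lift: "\<exists>s'. s' \<in> hom C S M \<and> Comp C i s' = s"
    if s: "s \<in> hom C S G" and r: "\<And>v x. v \<in> Obj J \<Longrightarrow> x \<in> elems S v \<Longrightarrow> component s v x \<in> I v" for s S
  proof -
    have "factors_through C s i"
      using factors_through_iff_range[OF s i(1)] i(2) r homD(2)[OF s] homD(2)[OF i(1)] M(2)
      by (auto simp: injective_def inj_on_def range_at_def image_iff)
    then show ?thesis
      unfolding factors_through_def homD(2)[OF s] homD(2)[OF i(1)] by metis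
  qed
  obtain p' where p': "p' \<in> hom C L M" "Comp C i p' = p" using lift[OF p] by (auto simp: I)
  obtain q' where q': "q' \<in> hom C D M" "Comp C i q' = q" using lift[OF q] by (auto simp: I)
  have "injective i" using i homD(2)[OF i(1)] by (simp add: injective_def inj_on_def)
  then have im: "monic C i" using monic_iff_injective[OF i(1)] by simp
  have "Comp C i (Comp C p' f) = Comp C i (Comp C q' g)"
    using Comp_assoc[OF C f p'(1) i(1)] Comp_assoc[OF C g q'(1) i(1)] p' q' pfqg by simp
  then have "Comp C p' f = Comp C q' g"
    using monic_cancel[OF im] Comp_in_hom[OF C f p'(1)] Comp_in_hom[OF C g q'(1)] homD(2)[OF i(1)]
    by simp
  then obtain u where u: "u \<in> hom C G M" "Comp C u p = p'" "Comp C u q = q'"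
    using pushout_ex1[OF po, of p' M q'] p' q' unfolding L_def D_def G_def by blast
  note iu = Comp_in_hom[OF C u(1) i(1)] and idG = Idn_in_hom[OF C ob(3)]
  have "Comp C (Comp C i u) p = p" "Comp C (Comp C i u) q = q"
    using Comp_assoc[OF C p u(1) i(1)] Comp_assoc[OF C q u(1) i(1)] u p' q' by simp_all
  moreover have "Comp C (Idn C G) p = p" "Comp C (Idn C G) q = q"
    using Idn_Comp[OF C p] Idn_Comp[OF C q] .
  ultimately have e: "Comp C i u = Idn C G"
    using pushout_ex1[OF po, of p G q] p q pfqg iu idG unfolding L_def D_def G_def by blast
  have "elems G v \<subseteq> I v"
  proof
    fix x assume x: "x \<in> elems G v"
    have m: "component u v x \<in> elems M v" using component_in[OF u(1) v x] .
    have "x = component u v x"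
      using component_Comp[OF u(1) i(1) v x] e component_Idn[OF ob(3) v x] i(2)[OF v m] by simp
    then show "x \<in> I v" using m M(2)[OF v] by simp
  qed
  then show ?thesis using sub[OF v] by (auto simp: I_def G_def)
qed

text \<open>The span \<open>(l, k)\<close> with \<open>l\<close> injective has a cocone into the sets \<open>D + (L - K)\<close>: elements of \<open>D\<close> are
  tagged by \<open>a\<close>, elements of \<open>L\<close> outside the image of \<open>l\<close> by \<open>b\<close>, and \<open>l z\<close> is sent to \<open>k z\<close>. It embeds
  \<open>D\<close> and identifies an element of \<open>L\<close> with one of \<open>D\<close> only if the former comes from \<open>K\<close>. It is
  the pushout, but only its being a cocone is proved: that suffices for
  \<open>pushout_along_injective\<close>.\<close>

lemma ex_gluing:
  assumes l: "l \<in> hom C K L" and k: "k \<in> hom C K D" and i: "injective l"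
  obtains Q p q where "p \<in> hom C L Q" "q \<in> hom C D Q" "Comp C p l = Comp C q k"
    "\<And>v. v \<in> Obj J \<Longrightarrow> inj_on (component q v) (elems D v)"
    "\<And>v x y. v \<in> Obj J \<Longrightarrow> x \<in> elems L v \<Longrightarrow> y \<in> elems D v \<Longrightarrow>
      component p v x = component q v y \<Longrightarrow> x \<in> range_at l v"
proof -
  obtain e :: "'u \<times> 'u \<Rightarrow> 'u" where e: "inj e"
    using ex_pairing by blast
  obtain a b :: 'u where ab: "a \<noteq> b"
    using ex_new_if_finite[OF infinite_UNIV, of "{undefined :: 'u}"] by auto
  have inv [simp]: "inv e (e w) = w" for w using e by simp
  have e_eq [simp]: "e w = e w' \<longleftrightarrow> w = w'" for w w' using e by (simp add: inj_eq)
  note kl = range_at_eq[OF l] and ob = wf_map_component(1,2)[OF l] wf_map_component(2)[OF k]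
  note D = Dom_in_Obj[OF J] Cod_in_Obj[OF J]
  define jL where "jL v x = (if x \<in> range_at l v
    then e (a, component k v (inv_into (elems K v) (component l v) x)) else e (b, x))" for v x
  have jLl: "jL v (component l v z) = e (a, component k v z)" if "v \<in> Obj J" "z \<in> elems K v" for v z
    using that inv_into_f_f[OF injectiveD[OF i l]] by (simp add: jL_def kl)
  have jLn: "jL v x = e (b, x)" if "x \<notin> range_at l v" for v x
    using that by (simp add: jL_def)
  \<comment> \<open>An element of \<open>L\<close> outside the image of \<open>l\<close> may be sent into that image by the action, which is
    why the second case applies \<open>jL\<close> again.\<close>
  define A where "A f w = (if fst (inv e w) = a then e (a, action D f (snd (inv e w)))
    else jL (Cod J f) (action L f (snd (inv e w))))" for f w
  have AD: "A f (e (a, y)) = e (a, action D f y)" for f y by (simp add: A_def)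
  have AL: "A f (jL (Dom J f) x) = jL (Cod J f) (action L f x)"
    if f: "f \<in> Arr J" and x: "x \<in> elems L (Dom J f)" for f x
  proof (cases "x \<in> range_at l (Dom J f)")
    case True
    then obtain z where z: "z \<in> elems K (Dom J f)" "x = component l (Dom J f) z" by (auto simp: kl)
    have "jL (Cod J f) (action L f x) = jL (Cod J f) (component l (Cod J f) (action K f z))"
      using component_action[OF l f z(1)] z(2) by simp
    also have "\<dots> = e (a, action D f (component k (Dom J f) z))"
      using jLl[of "Cod J f"] action_in[OF ob(1) f z(1)] D f component_action[OF k f z(1)] by simp
    finally show ?thesis using jLl[OF D(1)[OF f] z(1)] z(2) by (simp add: AD)
  next
    case False
    then show ?thesis using ab by (simp add: jLn A_def)
  qed
  define \<pi> where "\<pi> v w = (if fst (inv e w) = a then label D v (snd (inv e w))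
    else label L v (snd (inv e w)))" for v w
  have pD: "\<pi> v (e (a, y)) = label D v y" for v y by (simp add: \<pi>_def)
  have pL: "\<pi> v (jL v x) = label L v x" if v: "v \<in> Obj J" and x: "x \<in> elems L v" for v x
  proof (cases "x \<in> range_at l v")
    case True
    then obtain z where z: "z \<in> elems K v" "x = component l v z" by (auto simp: kl)
    then show ?thesis
      using jLl[OF v z(1)] label_component[OF k v z(1)] label_component[OF l v z(1)] by (simp add: pD)
  next
    case False
    then show ?thesis using ab by (simp add: jLn \<pi>_def)
  qed
  \<comment> \<open>As the union of two images, this set needs no case distinction on the image of \<open>l\<close>: the rules
    for \<open>e (a, y)\<close> and \<open>jL v x\<close> above cover it.\<close>
  define S where "S v = (\<lambda>y. e (a, y)) ` elems D v \<union> jL v ` elems L v" for v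
  have S: "P w" if "w \<in> S v" "\<And>y. y \<in> elems D v \<Longrightarrow> P (e (a, y))"
    "\<And>x. x \<in> elems L v \<Longrightarrow> P (jL v x)" for P v w
    using that by (auto simp: S_def)
  have SD: "e (a, y) \<in> S v" if "y \<in> elems D v" for v y using that by (auto simp: S_def)
  have SL: "jL v x \<in> S v" if "x \<in> elems L v" for v x using that by (auto simp: S_def)
  note aD = action_in[OF ob(3)] action_Idn[OF ob(3)] action_Comp[OF ob(3)] label_in[OF ob(3)]
    label_action[OF ob(3)]
  note aL = action_in[OF ob(2)] action_Idn[OF ob(2)] action_Comp[OF ob(2)] label_in[OF ob(2)]
    label_action[OF ob(2)]
  have "wf_over S A \<pi>"
    unfolding wf_over_def
  proof (intro conjI ballI impI)
    fix f w assume f: "f \<in> Arr J" and w: "w \<in> S (Dom J f)"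
    show "A f w \<in> S (Cod J f)"
      using w by (rule S) (simp_all add: AD AL[OF f] SD SL aD(1)[OF f] aL(1)[OF f])
    show "\<pi> (Cod J f) (A f w) = app (snd \<Sigma> f) (\<pi> (Dom J f) w)"
      using w by (rule S)
        (simp_all add: AD AL[OF f] pD pL D f aD(5)[OF f] aL(1)[OF f] aL(5)[OF f])
  next
    fix v w assume v: "v \<in> Obj J" and w: "w \<in> S v"
    have "A (Idn J v) (jL v x) = jL v x" if "x \<in> elems L v" for x
      using AL[of "Idn J v" x] homD[OF Idn_in_hom[OF J v]] aL(2)[OF v that] that by simp
    then show "A (Idn J v) w = w"
      using w by (intro S[OF w, of "\<lambda>w. A (Idn J v) w = w"]) (simp_all add: AD aD(2)[OF v])
    show "\<pi> v w \<in> fst \<Sigma> v"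
      using w by (rule S) (simp_all add: pD pL v aD(4) aL(4))
  next
    fix f g w assume fg: "f \<in> Arr J" "g \<in> Arr J" "Cod J f = Dom J g" and w: "w \<in> S (Dom J f)"
    have gf: "Comp J g f \<in> hom J (Dom J f) (Cod J g)"
      using Comp_in_hom[OF J, of f _ _ g] fg by (simp add: hom_iff)
    have "A (Comp J g f) (jL (Dom J f) x) = A g (A f (jL (Dom J f) x))" if x: "x \<in> elems L (Dom J f)" for x
      using AL[of "Comp J g f" x] AL[OF fg(1) x] AL[OF fg(2), of "action L f x"] homD[OF gf] x
        aL(1)[OF fg(1) x] aL(3)[OF fg x] fg(3) by simp
    then show "A (Comp J g f) w = A g (A f w)"
      by (intro S[OF w, of "\<lambda>w. A (Comp J g f) w = A g (A f w)"]) (simp_all add: AD aD(3)[OF fg])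
  qed
  then obtain Q where Q: "Q \<in> Obj C" "\<And>v. v \<in> Obj J \<Longrightarrow> elems Q v = S v"
    "\<And>v x. v \<in> Obj J \<Longrightarrow> x \<in> S v \<Longrightarrow> label Q v x = \<pi> v x"
    "\<And>f x. f \<in> Arr J \<Longrightarrow> x \<in> S (Dom J f) \<Longrightarrow> action Q f x = A f x"
    using ex_over by blast
  have "wf_map L Q jL" unfolding wf_map_def by (simp add: Q SL D AL pL)
  then obtain p where p: "p \<in> hom C L Q"
    "\<And>v x. v \<in> Obj J \<Longrightarrow> x \<in> elems L v \<Longrightarrow> component p v x = jL v x"
    using ex_map[OF ob(2) Q(1)] by blast
  have "wf_map D Q (\<lambda>v y. e (a, y))" unfolding wf_map_def by (simp add: Q SD D AD pD)
  then obtain q where q: "q \<in> hom C D Q"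
    "\<And>v x. v \<in> Obj J \<Longrightarrow> x \<in> elems D v \<Longrightarrow> component q v x = e (a, x)"
    using ex_map[OF ob(3) Q(1)] by blast
  show thesis
  proof (rule that[OF p(1) q(1)])
    show "Comp C p l = Comp C q k"
      by (rule hom_eqI[OF Comp_in_hom[OF C l p(1)] Comp_in_hom[OF C k q(1)]])
        (simp add: component_Comp[OF l p(1)] component_Comp[OF k q(1)] p(2) q(2) jLl
          component_in[OF l] component_in[OF k])
    show "inj_on (component q v) (elems D v)" if "v \<in> Obj J" for v
      using that by (auto simp: inj_on_def q(2))
    show "x \<in> range_at l v" if "v \<in> Obj J" "x \<in> elems L v" "y \<in> elems D v"
      "component p v x = component q v y" for v x y
      using that ab jLn[of x v] by (auto simp: p(2) q(2))
  qed
qed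

text \<open>The universal property maps the pushout object to the glued object compatibly with the two
  cocones. What the glued object keeps apart was therefore apart before.\<close>

lemma pushout_along_injective:
  assumes po: "pushout C l k m d" and i: "injective l"
  shows "injective d"
    and "v \<in> Obj J \<Longrightarrow> range_at m v \<inter> range_at d v = range_at (Comp C m l) v"
proof -
  define K L D G where "K = Dom C l" and "L = Cod C l" and "D = Cod C k" and "G = Cod C m"
  have l: "l \<in> hom C K L" and k: "k \<in> hom C K D"
    and m: "m \<in> hom C L G" and d: "d \<in> hom C D G" and eq: "Comp C m l = Comp C d k"
    using pushout_homs[OF po] by (simp_all add: K_def L_def D_def G_def)
  obtain Q p q where p: "p \<in> hom C L Q" and q: "q \<in> hom C D Q" and plqk: "Comp C p l = Comp C q k"
    and inj: "\<And>v. v \<in> Obj J \<Longrightarrow> inj_on (component q v) (elems D v)"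
    and meet: "\<And>v x y. v \<in> Obj J \<Longrightarrow> x \<in> elems L v \<Longrightarrow> y \<in> elems D v \<Longrightarrow>
      component p v x = component q v y \<Longrightarrow> x \<in> range_at l v"
    by (rule ex_gluing[OF l k i], rule that)
  obtain u where u: "u \<in> hom C G Q" "Comp C u m = p" "Comp C u d = q"
    using pushout_ex1[OF po, of p Q q] p q plqk unfolding L_def D_def G_def by blast
  have um: "component u v (component m v x) = component p v x" if "v \<in> Obj J" "x \<in> elems L v" for v x
    using component_Comp[OF m u(1) that] u(2) by simp
  have ud: "component u v (component d v y) = component q v y" if "v \<in> Obj J" "y \<in> elems D v" for v y
    using component_Comp[OF d u(1) that] u(3) by simp
  show "injective d"
    unfolding injective_def homD(2)[OF d]
  proof (intro ballI inj_onI)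
    fix v y y' assume v: "v \<in> Obj J" "y \<in> elems D v" "y' \<in> elems D v"
      "component d v y = component d v y'"
    then show "y = y'"
      using ud[OF v(1,2)] ud[OF v(1,3)] inj_onD[OF inj[OF v(1)]] by simp
  qed
  note ml = Comp_in_hom[OF C l m]
  assume v: "v \<in> Obj J"
  show "range_at m v \<inter> range_at d v = range_at (Comp C m l) v"
  proof (intro equalityI subsetI)
    fix g assume "g \<in> range_at m v \<inter> range_at d v"
    then obtain x y where xy: "x \<in> elems L v" "g = component m v x" "y \<in> elems D v" "g = component d v y"
      by (auto simp: range_at_eq[OF m] range_at_eq[OF d])
    then have "x \<in> range_at l v" using meet[OF v xy(1,3)] um[OF v xy(1)] ud[OF v xy(3)] by simp
    then obtain z where "z \<in> elems K v" "x = component l v z" by (auto simp: range_at_eq[OF l])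
    then show "g \<in> range_at (Comp C m l) v"
      using xy(2) component_Comp[OF l m v] by (auto simp: range_at_eq[OF ml])
  next
    fix g assume "g \<in> range_at (Comp C m l) v"
    then obtain z where z: "z \<in> elems K v" "g = component (Comp C m l) v z"
      by (auto simp: range_at_eq[OF ml])
    then have "g = component m v (component l v z)" "g = component d v (component k v z)"
      using component_Comp[OF l m v z(1)] component_Comp[OF k d v z(1)] eq by simp_all
    then show "g \<in> range_at m v \<inter> range_at d v"
      using component_in[OF l v z(1)] component_in[OF k v z(1)]
      unfolding range_at_eq[OF m] range_at_eq[OF d] by blast
  qed
qed

section \<open>Stable subobjects of a derivation\<close>

text \<open>That \<open>d\<close> is monic comes from the pushout along \<open>l\<close>, that \<open>h\<close> is monic from the one along \<open>r\<close>.
  Stability of \<open>A\<close> is then the set-theoretic equivalence of \<open>A \<inter> L \<subseteq> K\<close> and \<open>A \<subseteq> D\<close> at each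
  object.\<close>

lemma dpo_stable_subobjects:
  assumes dpo: "dpo_derivation C l r m k d h n"
  shows "monic C d" "monic C h" "Cod C d = Cod C m" "Dom C h = Dom C d"
    and "monic C a \<Longrightarrow> Cod C a = Cod C m \<Longrightarrow>
      rho_stable C l m (subobj C a) \<longleftrightarrow> factors_through C a d"
proof -
  have po: "pushout C l k m d" and po': "pushout C r k n h"
    and mono: "monic C l" "monic C r" "monic C m"
    using dpo by (auto simp: dpo_derivation_def linear_rule_def)
  note hs = pushout_homs[OF po] and hs' = pushout_homs[OF po']
  have il: "injective l" and ir: "injective r"
    using mono monic_iff_injective hs(1) hs'(1) by blast+
  show md: "monic C d" and "monic C h"
    using pushout_along_injective(1) po il po' ir monic_iff_injective hs(4) hs'(4) by blast+
  show "Cod C d = Cod C m" "Dom C h = Dom C d" using homD(2,3)[OF hs(4)] homD(2)[OF hs'(4)] by simp_all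
  assume a: "monic C a" "Cod C a = Cod C m"
  have ah: "a \<in> hom C (Dom C a) (Cod C m)" using a by (simp add: monic_def hom_iff)
  note ml = Comp_in_hom[OF C hs(1,3)]
  have mml: "monic C (Comp C m l)"
    by (rule monic_Comp[OF C hs(1) mono(1) hs(3) mono(3)])
  have *: "A \<inter> M \<subseteq> K \<longleftrightarrow> A \<subseteq> D"
    if "M \<inter> D = K" "A \<subseteq> M \<union> D" for A M K D :: "'u set"
    using that by blast
  have "rho_stable C l m (subobj C a) \<longleftrightarrow>
      (\<forall>v\<in>Obj J. range_at a v \<inter> range_at m v \<subseteq> range_at (Comp C m l) v)"
    unfolding rho_stable_def by (rule meet_le_iff_range[OF ah hs(3) ml a(1) mono(3) mml])
  also have "\<dots> \<longleftrightarrow> (\<forall>v\<in>Obj J. range_at a v \<subseteq> range_at d v)"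
  proof (intro ball_cong refl *)
    fix v assume v: "v \<in> Obj J"
    show "range_at m v \<inter> range_at d v = range_at (Comp C m l) v"
      by (rule pushout_along_injective(2)[OF po il v])
    show "range_at a v \<subseteq> range_at m v \<union> range_at d v"
      unfolding pushout_jointly_surjective[OF po v, symmetric]
      using component_in[OF ah v] by (auto simp: range_at_eq[OF ah])
  qed
  also have "\<dots> \<longleftrightarrow> factors_through C a d"
    using factors_through_iff_range[OF ah hs(4)] md monic_iff_injective[OF hs(4)] by simp
  finally show "rho_stable C l m (subobj C a) \<longleftrightarrow> factors_through C a d" .
qed

end

theorem theorem5p3:
  fixes \<Sigma> :: "'u::infinite hypergraph"
  assumes "\<Sigma> \<in> Obj hypergraphs"
    and "C = slice hypergraphs \<Sigma>"
    and "dpo_derivation C l r m k d h n"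
  shows "(\<forall>a. monic C a \<and> Cod C a = Cod C m \<longrightarrow>
            (rho_stable C l m (subobj C a) \<longleftrightarrow> sub_le C (subobj C a) (subobj C d)) \<and>
            (sub_le C (subobj C a) (subobj C d) \<longleftrightarrow> factors_through C a d)) \<and>
         Stab C l m = {A \<in> Sub C (Cod C m). sub_le C A (subobj C d)} \<and>
         transported_intact C l m d h (subobj C d) \<and>
         (\<forall>A. transported_intact C l m d h A \<longrightarrow> sub_le C A (subobj C d))"
proof -
  have "category hyp_cat" by (simp add: hyp_cat_def category_free_cat)
  moreover have "is_functor hyp_cat set_cat \<Sigma>"
    using assms(1) by (simp add: hypergraphs_def functor_cat_def)
  ultimately interpret set_functors_over hyp_cat \<Sigma>
    by unfold_locales
  have "category C" by (simp add: assms(2) category_slice_hypergraphs)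
  moreover note dpo_stable_subobjects[OF assms(3)[unfolded assms(2) hypergraphs_def],
      folded hypergraphs_def, folded assms(2)]
  ultimately show ?thesis by (rule stable_iff_factors_consequences)
qed

end
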